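(* For any $1\le\beta<2$ and any $a\neq0$, the hierarchical Sine-Gordon measure and the hierarchical GFF measure are mutually singular: $$\mathbb P^{SG}_{\mathrm{hr},\beta,a}\perp\mathbb P^{GFF}_{\mathrm{hr}}.$$
   Context: Fix an integer $L\ge2$, dimension $d=2$. Let $\Lambda_n=\{x\in\mathbb Z^2:0\le x_i<L^n\}$ and $\bar\Lambda_n=L^{-n}\Lambda_n\subset[0,1)^2$. Let $\Omega$ be the product space of families $(z^{(n)}_x)_{n\ge0,\,x\in\Lambda_n}$ of real numbers with its product $\sigma$-field. $\mathbb P^{GFF}_{\mathrm{hr}}$ is the probability measure on $\Omega$ under which all $z^{(n)}_x$ are i.i.d. centred Gaussian with variance $2\log L$. Let $\mathcal F_n$ be generated by $(z^{(k)}_x)_{0\le k\le n,\,x\in\Lambda_k}$. Set $\varphi^n_{\mathrm{hr}}(x)=\sum_{k=0}^n z^{(k)}_{[L^kx]}$ for $x\in[0,1)^2$, where $[\cdot]$ is the componentwise integer part. For $0<\beta<2$ ($\beta_{BKT}=2$ in this normalisation) and $a\ne0$, the hierarchical Sine-Gordon measure $\mathbb P^{SG}_{\mathrm{hr},\beta,a}$ is the probability measure on $\Omega$ which is the limit in law as $N\to\infty$ (for the topology induced by the finite-depth layers: for every fixed $n$, the law on $\mathcal F_n$ converges) of the probability measures $$\frac1{Z^{(N)}}\exp\Big(-\sum_{x\in\bar\Lambda_N}aL^{-N(2-\beta)}\cos\big(\sqrt\beta\,\varphi^N_{\mathrm{hr}}(x)\big)\Big)\,d\mathbb P^{GFF}_{\mathrm{hr}}.$$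 Equivalently, for every $n\ge1$, $\frac{d\mathbb P^{SG}_{\mathrm{hr},\beta,a}}{d\mathbb P^{GFF}_{\mathrm{hr}}}\big|_{\mathcal F_n}\propto\exp(-\sum_{x\in\bar\Lambda_n}v_n^{\infty,a}(\varphi^n_{\mathrm{hr}}(x)))$, where $v_n^{\infty,a}$ is the limit as $N\to\infty$, in sup norm and modulo additive constants, of $\mathcal R^{N-n}$ applied to $\phi\mapsto aL^{-N(2-\beta)}\cos(\sqrt\beta\phi)$, and $(\mathcal Rv)(\phi')=-\log\mathbb E[e^{-\sum_{x\in\Lambda_1}v(\phi'+z(x))}]$ with $(z(x))_{x\in\Lambda_1}$ i.i.d. $\mathcal N(0,2\log L)$. (Existence of this limit is part of the paper's construction.) *)

theory Defs
  imports "HOL-Probability.Probability"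
begin

definition Lam :: "nat \<Rightarrow> nat \<Rightarrow> (int \<times> int) set" where
  "Lam L n = {0..<int L ^ n} \<times> {0..<int L ^ n}"

definition barLam :: "nat \<Rightarrow> nat \<Rightarrow> (real \<times> real) set" where
  "barLam L n =
     (\<lambda>(i, j). (real_of_int i / real L ^ n, real_of_int j / real L ^ n)) ` Lam L n"

text \<open>
  A sample point is a function \<open>\<omega>\<close> with \<open>\<omega> (k, x)\<close> the variable at level \<open>k\<close> and site
  \<open>x\<close>; as usual for product measures it is extensional outside the index set.
\<close>

definition layers :: "nat \<Rightarrow> (nat \<times> int \<times> int) set" where
  "layers L = (SIGMA k:UNIV. Lam L k)"

definition layers_upto :: "nat \<Rightarrow> nat \<Rightarrow> (nat \<times> int \<times> int) set" where
  "layers_upto L n = (SIGMA k:{..n}. Lam L k)"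

text \<open>\<^const>\<open>normal_density\<close> takes the standard deviation, so the variance is \<open>2 log L\<close>.\<close>

definition hGFF :: "nat \<Rightarrow> (nat \<times> int \<times> int \<Rightarrow> real) measure" where
  "hGFF L = PiM (layers L) (\<lambda>_. density lborel (normal_density 0 (sqrt (2 * ln (real L)))))"

definition hfield ::
    "nat \<Rightarrow> nat \<Rightarrow> (nat \<times> int \<times> int \<Rightarrow> real) \<Rightarrow> real \<times> real \<Rightarrow> real" where
  "hfield L n \<omega> x =
     (\<Sum>k=0..n. \<omega> (k, (\<lfloor>real L ^ k * fst x\<rfloor>, \<lfloor>real L ^ k * snd x\<rfloor>)))"

definition SG_weight ::
    "nat \<Rightarrow> real \<Rightarrow> real \<Rightarrow> nat \<Rightarrow> (nat \<times> int \<times> int \<Rightarrow> real) \<Rightarrow> real" where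
  "SG_weight L \<beta> a N \<omega> =
     exp (- (\<Sum>x\<in>barLam L N.
       a * real L powr (- real N * (2 - \<beta>)) * cos (sqrt \<beta> * hfield L N \<omega> x)))"

definition hSG_cutoff ::
    "nat \<Rightarrow> real \<Rightarrow> real \<Rightarrow> nat \<Rightarrow> (nat \<times> int \<times> int \<Rightarrow> real) measure" where
  "hSG_cutoff L \<beta> a N =
     density (hGFF L)
       (\<lambda>\<omega>. ennreal (SG_weight L \<beta> a N \<omega> / (\<integral>\<omega>'. SG_weight L \<beta> a N \<omega>' \<partial>hGFF L)))"

text \<open>
  \<open>P\<close> is the hierarchical Sine-Gordon measure: for every \<open>n\<close>, the law of the finitely many
  variables in the layers up to \<open>n\<close> under the cutoff measures converges weakly to their law
  under \<open>P\<close>.  Continuity refers to the product topology on the function type; on functions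
  restricted to \<open>layers_upto L n\<close> this is the Euclidean topology of the finite-dimensional space
  of these variables.  These finite-dimensional laws determine \<open>P\<close>, hence there is at most one
  such \<open>P\<close>.
\<close>

definition is_hSG ::
    "nat \<Rightarrow> real \<Rightarrow> real \<Rightarrow> (nat \<times> int \<times> int \<Rightarrow> real) measure \<Rightarrow> bool" where
  "is_hSG L \<beta> a P \<longleftrightarrow>
     prob_space P \<and> sets P = sets (hGFF L) \<and>
     (\<forall>n. \<forall>f :: (nat \<times> int \<times> int \<Rightarrow> real) \<Rightarrow> real.
        continuous_on UNIV f \<longrightarrow> bounded (range f) \<longrightarrow>
        (\<lambda>N. \<integral>\<omega>. f (restrict \<omega> (layers_upto L n)) \<partial>hSG_cutoff L \<beta> a N)
          \<longlonglongrightarrow> (\<integral>\<omega>. f (restrict \<omega> (layers_upto L n)) \<partial>P))"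

definition mutually_singular :: "'a measure \<Rightarrow> 'a measure \<Rightarrow> bool" where
  "mutually_singular M N \<longleftrightarrow>
     sets M = sets N \<and> (\<exists>A\<in>sets M. emeasure M A = 0 \<and> emeasure N (space N - A) = 0)"

end

theory Submission
  imports Defs
begin

text \<open>
  Integrating out the layers above \<open>k\<close> of the cutoff measure leaves a product over sites of
  single-site weights \<open>W\<^sub>k\<close>, where \<open>W\<^sub>k\<close> is the \<open>L\<^sup>2\<close>-th power of the Gaussian average of
  \<open>W\<close> at level \<open>k + 1\<close>. On functions without zero mode, averaging followed by multiplication by
  \<open>L\<^sup>2\<close> expands the Fourier \<open>\<ell>\<^sup>1\<close> norm by at most \<open>b = L powr (2 - \<beta>)\<close>, while second-order errors
  are allowed to grow by \<open>b\<^sup>2\<close> per step, like the square of the coupling. Hence, uniformly in the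
  cutoff, \<open>W\<^sub>k\<close> is proportional to \<open>1 + \<alpha>\<^sub>k * cos (sqrt \<beta> * \<phi>) + O(\<alpha>\<^sub>k\<^sup>2)\<close> with
  \<open>\<alpha>\<^sub>k = - a * L powr (- k * (2 - \<beta>))\<close>. So, conditionally on the previous layers, the mean of
  \<open>cos (sqrt \<beta> * \<phi>)\<close> at each site of layer \<open>k\<close> is shifted by an amount of order \<open>\<alpha>\<^sub>k\<close>. Summing the
  centred cosines over the \<open>L ^ (2 * k)\<close> sites with weight \<open>1 / L ^ k\<close> gives an increment of bounded
  variance whose mean is shifted by order \<open>L powr (k * (\<beta> - 1))\<close>, which is bounded below since
  \<open>\<beta> \<ge> 1\<close>. Exponential moments of the sum of the increments over \<open>n\<close> layers therefore
  separate the two measures exponentially fast in \<open>n\<close>, and Borel--Cantelli applies.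
\<close>

section \<open>Absolutely convergent cosine series\<close>

text \<open>
  \<open>wiener \<kappa> p M f\<close>: the function \<open>f\<close> is a cosine series with frequencies in
  \<open>{p, p + 1, \<dots>} * \<kappa>\<close> and coefficients of total absolute value at most \<open>M\<close>. The closure rules
  stand in for an explicit coefficient sequence, so that products, Gaussian averages and splitting off
  the zero mode need no reindexing of double series.
\<close>

inductive wiener :: "real \<Rightarrow> nat \<Rightarrow> real \<Rightarrow> (real \<Rightarrow> real) \<Rightarrow> bool" for \<kappa> :: real and p :: nat where
  wiener_cos: "p \<le> m \<Longrightarrow> wiener \<kappa> p 1 (\<lambda>x. cos (real m * \<kappa> * x))"
| wiener_scale: "wiener \<kappa> p M f \<Longrightarrow> \<bar>c\<bar> * M \<le> M' \<Longrightarrow> wiener \<kappa> p M' (\<lambda>x. c * f x)"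
| wiener_sums: "(\<And>i::nat. wiener \<kappa> p (M i) (f i)) \<Longrightarrow> summable M \<Longrightarrow> suminf M \<le> M' \<Longrightarrow>
    (\<And>x. (\<lambda>i. f i x) sums g x) \<Longrightarrow> wiener \<kappa> p M' g"

lemma wiener_abs_le:
  assumes "wiener \<kappa> p M f"
  shows "\<bar>f x\<bar> \<le> M"
  using assms
proof (induction arbitrary: x)
  case (wiener_scale M f c M')
  have "\<bar>c * f x\<bar> \<le> \<bar>c\<bar> * M"
    by (simp add: abs_mult mult_left_mono wiener_scale.IH)
  then show ?case using wiener_scale.hyps by linarith
next
  case (wiener_sums M f M' g)
  have "summable (\<lambda>i. \<bar>f i x\<bar>)"
    by (rule summable_comparison_test'[OF wiener_sums.hyps(2)]) (simp add: wiener_sums.IH)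
  then have "\<bar>\<Sum>i. f i x\<bar> \<le> (\<Sum>i. M i)"
    by (intro order.trans[OF summable_rabs] suminf_le wiener_sums)
  then show ?case using wiener_sums.hyps(3,4) sums_unique by (metis order.trans)
qed (simp add: abs_cos_le_one)

lemma wiener_nonneg: "wiener \<kappa> p M f \<Longrightarrow> 0 \<le> M"
  using wiener_abs_le[of \<kappa> p M f 0] by linarith

lemma wiener_measurable:
  assumes "wiener \<kappa> p M f"
  shows "f \<in> borel_measurable borel"
  using assms
proof induction
  case (wiener_sums M f M' g)
  have "g = (\<lambda>x. \<Sum>i. f i x)" using wiener_sums.hyps(4) sums_unique by blast
  with wiener_sums.IH show ?case by simp
qed simp_all

lemma wiener_mono: "wiener \<kappa> p M f \<Longrightarrow> M \<le> M' \<Longrightarrow> wiener \<kappa> p M' f"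
  using wiener_scale[of \<kappa> p M f 1 M'] by simp

lemma wiener_antimono: "wiener \<kappa> p M f \<Longrightarrow> p' \<le> p \<Longrightarrow> wiener \<kappa> p' M f"
  by (induction rule: wiener.induct) (auto intro: wiener.intros order.trans)

lemma wiener_zero: "wiener \<kappa> p 0 (\<lambda>_. 0)"
  using wiener_scale[OF wiener_cos[of p p \<kappa>], of 0 0] by simp

text \<open>A finite sum has no closure rule of its own; it is a series whose terms vanish from
  index 2 on.\<close>

lemma wiener_add:
  assumes "wiener \<kappa> p M f" "wiener \<kappa> p M' g"
  shows "wiener \<kappa> p (M + M') (\<lambda>x. f x + g x)"
proof (rule wiener_sums)
  let ?M = "\<lambda>i::nat. if i = 0 then M else if i = 1 then M' else 0"
  let ?f = "\<lambda>i::nat. if i = 0 then f else if i = 1 then g else (\<lambda>_. 0)"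
  have *: "(\<lambda>i::nat. if i = 0 then a else if i = 1 then b else 0) sums (a + b)" for a b :: real
    using sums_finite[of "{0, 1}" "\<lambda>i::nat. if i = 0 then a else if i = 1 then b else 0"] by simp
  show "wiener \<kappa> p (?M i) (?f i)" for i using assms by (simp add: wiener_zero)
  show "summable ?M" "suminf ?M \<le> M + M'" using *[of M M'] by (auto simp: sums_iff)
  have "(\<lambda>i. ?f i x) = (\<lambda>i. if i = 0 then f x else if i = 1 then g x else 0)" for x by auto
  then show "(\<lambda>i. ?f i x) sums (f x + g x)" for x using *[of "f x" "g x"] by metis
qed

lemma wiener_const: "wiener \<kappa> 0 \<bar>c\<bar> (\<lambda>_. c)"
  using wiener_scale[OF wiener_cos[of 0 0 \<kappa>], of c "\<bar>c\<bar>"] by simp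

lemma wiener_cos1: "p \<le> 1 \<Longrightarrow> wiener \<kappa> p \<bar>c\<bar> (\<lambda>x. c * cos (\<kappa> * x))"
  using wiener_scale[OF wiener_cos[of p 1 \<kappa>], of c "\<bar>c\<bar>"] by simp

text \<open>The product of two cosines is a mean of two cosines, so the norm is submultiplicative;
  scaling and series then pass through one factor at a time. The form \<open>p = 0\<close> is
  natural here because equal frequencies create a zero mode.\<close>

lemma wiener_mult:
  assumes "wiener \<kappa> 0 M f" "wiener \<kappa> 0 M' g"
  shows "wiener \<kappa> 0 (M * M') (\<lambda>x. f x * g x)"
  using assms(1)
proof induction
  case (wiener_cos m)
  show ?case using assms(2)
  proof induction
    case (wiener_cos n)
    \<comment> \<open>\<open>max m n - min m n\<close> is the distance of the two frequencies, safe
      from truncated subtraction; evenness of the cosine disposes of the sign.\<close>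
    have *: "cos (real m * \<kappa> * x) * cos (real n * \<kappa> * x) =
      1/2 * cos (real (m + n) * \<kappa> * x) + 1/2 * cos (real (max m n - min m n) * \<kappa> * x)" for x
    proof -
      define u v where "u = real m * \<kappa> * x" and "v = real n * \<kappa> * x"
      have "real (max m n - min m n) * \<kappa> * x = (if m \<le> n then - (u - v) else u - v)"
        by (simp add: max_def min_def of_nat_diff left_diff_distrib u_def v_def)
      then have "cos (real (max m n - min m n) * \<kappa> * x) = cos (u - v)"
        by (simp only: cos_minus split: if_split) simp
      moreover have "real (m + n) * \<kappa> * x = u + v"
        by (simp add: distrib_right u_def v_def)
      moreover have "cos u * cos v = 1/2 * cos (u + v) + 1/2 * cos (u - v)"
        unfolding cos_times_cos by (simp add: add_divide_distrib)
      ultimately show ?thesis by (simp only: u_def v_def)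
    qed
    have "wiener \<kappa> 0 (1/2 + 1/2) (\<lambda>x. cos (real m * \<kappa> * x) * cos (real n * \<kappa> * x))"
      unfolding * by (intro wiener_add wiener_scale[where M=1] wiener.wiener_cos) simp_all
    then show ?case by simp
  next
    case (wiener_scale M f c M')
    then show ?case
      using wiener.wiener_scale[OF wiener_scale.IH, of c M'] by (simp add: mult.left_commute)
  next
    case (wiener_sums M f M' g)
    show ?case
    proof (rule wiener.wiener_sums[OF wiener_sums.IH])
      show "summable (\<lambda>i. 1 * M i)" "(\<Sum>i. 1 * M i) \<le> 1 * M'" using wiener_sums.hyps by simp_all
      show "(\<lambda>i. cos (real m * \<kappa> * x) * f i x) sums (cos (real m * \<kappa> * x) * g x)" for x
        by (rule sums_mult) (rule wiener_sums.hyps)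
    qed
  qed
next
  case (wiener_scale N f c N')
  have "\<bar>c\<bar> * (N * M') \<le> N' * M'"
    using mult_right_mono[OF wiener_scale.hyps(2) wiener_nonneg[OF assms(2)]] by (simp add: mult.assoc)
  from wiener.wiener_scale[OF wiener_scale.IH this] show ?case by (simp add: mult.assoc)
next
  case (wiener_sums N f N' h)
  show ?case
  proof (rule wiener.wiener_sums[OF wiener_sums.IH])
    show "summable (\<lambda>i. N i * M')" by (rule summable_mult2) (rule wiener_sums.hyps)
    show "(\<Sum>i. N i * M') \<le> N' * M'"
      using mult_right_mono[OF wiener_sums.hyps(3) wiener_nonneg[OF assms(2)]]
      by (simp add: suminf_mult2[OF wiener_sums.hyps(2), symmetric])
    show "(\<lambda>i. f i x * g x) sums (h x * g x)" for x
      by (rule sums_mult2) (rule wiener_sums.hyps)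
  qed
qed

text \<open>\<open>A\<close> is the zero mode. Its size and the norm of the rest add up to at most
  \<open>M\<close>, so splitting loses no constant. In the series case both parts are dominated by
  the summable bounds \<open>M i\<close>.\<close>

lemma wiener_split:
  assumes "wiener \<kappa> 0 M f"
  obtains A B h where "\<And>x. f x = A + h x" "\<bar>A\<bar> + B \<le> M" "wiener \<kappa> 1 B h"
proof -
  have "\<exists>A B h. (\<forall>x. f x = A + h x) \<and> \<bar>A\<bar> + B \<le> M \<and> wiener \<kappa> 1 B h"
    using assms
  proof induction
    case (wiener_cos m)
    show ?case
    proof (cases "m = 0")
      case True
      then show ?thesis by (intro exI[of _ 1] exI[of _ 0] exI[of _ "\<lambda>_. 0"]) (simp add: wiener_zero)
    next
      case False
      then show ?thesis
        by (intro exI[of _ 0] exI[of _ 1] exI[of _ "\<lambda>x. cos (real m * \<kappa> * x)"])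
          (simp add: wiener.wiener_cos)
    qed
  next
    case (wiener_scale M f c M')
    then obtain A B h where h: "\<forall>x. f x = A + h x" "\<bar>A\<bar> + B \<le> M" "wiener \<kappa> 1 B h" by blast
    have "\<bar>c\<bar> * (\<bar>A\<bar> + B) \<le> M'"
      using mult_left_mono[OF h(2), of "\<bar>c\<bar>"] wiener_scale.hyps(2) by linarith
    then show ?case using h(1,3)
      by (intro exI[of _ "c * A"] exI[of _ "\<bar>c\<bar> * B"] exI[of _ "\<lambda>x. c * h x"])
        (simp add: abs_mult wiener.wiener_scale algebra_simps)
  next
    case (wiener_sums M f M' g)
    then obtain A B h where h: "\<And>i x. f i x = A i + h i x" "\<And>i. \<bar>A i\<bar> + B i \<le> M i"
      "\<And>i. wiener \<kappa> 1 (B i) (h i)" by metis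
    note nn = wiener_nonneg[OF h(3)]
    have "norm \<bar>A i\<bar> \<le> M i" for i using h(2)[of i] nn[of i] by simp
    then have A: "summable (\<lambda>i. \<bar>A i\<bar>)"
      by (intro summable_comparison_test'[OF wiener_sums.hyps(2)]) auto
    have "norm (B i) \<le> M i" for i using h(2)[of i] nn[of i] by simp
    then have B: "summable B" by (intro summable_comparison_test'[OF wiener_sums.hyps(2)]) auto
    have "\<bar>suminf A\<bar> + suminf B \<le> M'"
      using suminf_le[OF h(2) summable_add[OF A B] wiener_sums.hyps(2)] summable_rabs[OF A]
        suminf_add[OF A B] wiener_sums.hyps(3) by linarith
    moreover have "wiener \<kappa> 1 (suminf B) (\<lambda>x. g x - suminf A)"
    proof (rule wiener.wiener_sums[OF h(3) B])
      show "(\<lambda>i. h i x) sums (g x - suminf A)" for x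
        using sums_diff[OF wiener_sums.hyps(4) summable_sums[OF summable_rabs_cancel[OF A]], of x] h(1)
        by simp
    qed simp
    ultimately show ?case
      by (intro exI[of _ "suminf A"] exI[of _ "suminf B"] exI[of _ "\<lambda>x. g x - suminf A"]) simp
  qed
  with that show thesis by blast
qed

text \<open>The remainder is a polynomial in \<open>y\<close> with nonnegative coefficients, so its
  norm is at most the same polynomial at \<open>r\<close>.\<close>

lemma wiener_power_remainder:
  assumes "wiener \<kappa> 0 r y"
  shows "wiener \<kappa> 0 ((1 + r) ^ n - 1 - n * r) (\<lambda>x. (1 + y x) ^ n - 1 - n * y x)"
proof (induction n)
  case (Suc n)
  \<comment> \<open>This recursion involves no cancellation, so the norm bound obeys it with
    \<open>r\<close> in place of \<open>y\<close>.\<close>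
  have eq: "(1 + y) ^ Suc n - 1 - Suc n * y = ((1 + y) ^ n - 1 - n * y) * (1 + y) + n * (y * y)" for y :: real
    by (simp add: algebra_simps)
  have "wiener \<kappa> 0 (((1 + r) ^ n - 1 - n * r) * (1 + r) + n * (r * r))
      (\<lambda>x. ((1 + y x) ^ n - 1 - n * y x) * (1 + y x) + n * (y x * y x))"
    using wiener_const[of \<kappa> 1]
    by (intro wiener_add wiener_mult Suc assms wiener_scale[OF wiener_mult[OF assms assms]]) simp_all
  then show ?case by (simp only: eq)
qed (simp add: wiener_zero)

text \<open>The same positivity argument, for the exponential series from degree 2 on.\<close>

lemma wiener_exp_remainder:
  assumes "wiener \<kappa> 0 r y"
  shows "wiener \<kappa> 0 (exp r - 1 - r) (\<lambda>x. exp (y x) - 1 - y x)"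
proof -
  have pow: "wiener \<kappa> 0 (r ^ n) (\<lambda>x. y x ^ n)" for n
  proof (induction n)
    case 0 then show ?case using wiener_const[of \<kappa> 1] by simp
  qed (simp add: wiener_mult assms)
  have s: "(\<lambda>n. u ^ (n + 2) / fact (n + 2)) sums (exp u - 1 - u)" for u :: real
  proof -
    have "(\<lambda>n. u ^ n / fact n) sums exp u" using exp_converges[of u] by (simp add: field_simps)
    from sums_split_initial_segment[OF this, of 2] show ?thesis
      by (simp add: numeral_2_eq_2 algebra_simps)
  qed
  show ?thesis
  proof (rule wiener_sums)
    show "wiener \<kappa> 0 (r ^ (n + 2) / fact (n + 2)) (\<lambda>x. y x ^ (n + 2) / fact (n + 2))" for n
      using wiener_scale[OF pow[of "n + 2"], of "1 / fact (n + 2)"] by simp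
      show "summable (\<lambda>n. r ^ (n + 2) / fact (n + 2))" by (rule sums_summable[OF s])
    show "(\<Sum>n. r ^ (n + 2) / fact (n + 2)) \<le> exp r - 1 - r" using sums_unique[OF s, of r] by linarith
  qed (rule s)
qed

section \<open>Gaussian averaging\<close>

abbreviation gauss :: "real \<Rightarrow> real measure" where
  "gauss \<sigma> \<equiv> density lborel (normal_density 0 \<sigma>)"

definition smooth :: "real \<Rightarrow> (real \<Rightarrow> real) \<Rightarrow> real \<Rightarrow> real" where
  "smooth \<sigma> f x = (\<integral>z. f (x + z) \<partial>gauss \<sigma>)"

text \<open>Real part of the characteristic function of the standard normal law, of which
  \<open>gauss \<sigma>\<close> is the image under scaling by \<open>\<sigma>\<close>.\<close>

lemma integral_gauss_cos:
  assumes "\<sigma> > 0"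
  shows "(\<integral>z. cos (c * (x + z)) \<partial>gauss \<sigma>) = exp (- (c * \<sigma>)\<^sup>2 / 2) * cos (c * x)"
proof -
  interpret std: prob_space std_normal_distribution by (rule prob_space_normal_density) simp
  interpret real_distribution std_normal_distribution by (rule real_dist_normal_dist)
  have "distributed std_normal_distribution lborel (\<lambda>z. z) std_normal_density"
    by (simp add: distributed_def distr_id2)
  from std.normal_density_affine[OF this, of \<sigma> 0] assms
  have "distributed std_normal_distribution lborel (\<lambda>z. \<sigma> * z) (normal_density 0 \<sigma>)" by simp
  then have g: "gauss \<sigma> = distr std_normal_distribution lborel (\<lambda>z. \<sigma> * z)"
    by (simp add: distributed_def)
  have re: "Re (iexp u * iexp v) = cos (u + v)" "Re (iexp u * complex_of_real v) = v * cos u" for u v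
    by (simp_all add: cis_mult flip: cis_conv_exp)
  have "(\<integral>z. cos (c * (x + z)) \<partial>gauss \<sigma>) = (\<integral>z. cos (c * (x + \<sigma> * z)) \<partial>std_normal_distribution)"
    unfolding g by (rule integral_distr) simp_all
  also have "\<dots> = (\<integral>z. Re (iexp (c * x) * iexp (c * \<sigma> * z)) \<partial>std_normal_distribution)"
    unfolding re by (simp add: distrib_left mult.assoc)
  also have "\<dots> = Re (iexp (c * x) * char std_normal_distribution (c * \<sigma>))"
    unfolding char_def
    by (subst integral_Re) (simp_all add: std.integrable_iexp)
  finally show ?thesis
    by (simp only: char_std_normal_distribution re)
qed

context
  fixes \<sigma> :: real
  assumes \<sigma>: "\<sigma> > 0"
begin

interpretation prob_space "gauss \<sigma>" using \<sigma> by (rule prob_space_normal_density)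

lemma integrable_gauss_bounded:
  assumes "f \<in> borel_measurable borel" "\<And>x. \<bar>f x\<bar> \<le> M"
  shows "integrable (gauss \<sigma>) (\<lambda>z. f (x + z) :: real)"
  using assms by (intro integrable_const_bound[of _ M]) auto

lemma integrable_wiener:
  "wiener \<kappa> p M f \<Longrightarrow> integrable (gauss \<sigma>) (\<lambda>z. f (x + z))"
  using wiener_measurable wiener_abs_le by (rule integrable_gauss_bounded)

lemma smooth_const [simp]: "smooth \<sigma> (\<lambda>_. c) x = c"
  using prob_space by (simp add: smooth_def)

lemma smooth_add:
  "wiener \<kappa> p M f \<Longrightarrow> wiener \<kappa>' p' M' g \<Longrightarrow> smooth \<sigma> (\<lambda>x. f x + g x) x = smooth \<sigma> f x + smooth \<sigma> g x"
  unfolding smooth_def by (intro Bochner_Integration.integral_add integrable_wiener)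

lemma smooth_scale: "smooth \<sigma> (\<lambda>x. c * f x) x = c * smooth \<sigma> f x"
  by (simp add: smooth_def)

lemma smooth_cos: "smooth \<sigma> (\<lambda>x. cos (c * x)) x = exp (- (c * \<sigma>)\<^sup>2 / 2) * cos (c * x)"
  using integral_gauss_cos[OF \<sigma>] by (simp add: smooth_def)

text \<open>Averaging damps the mode \<open>m\<close> by a factor that decreases in
  \<open>m\<close>, so the mode \<open>p\<close> gives the worst one. For \<open>p = 1\<close> this
  is the factor \<open>q\<close> gained by functions without zero mode.\<close>

lemma wiener_smooth:
  assumes "wiener \<kappa> p M f"
  shows "wiener \<kappa> p (exp (- (real p * \<kappa> * \<sigma>)\<^sup>2 / 2) * M) (smooth \<sigma> f)"
  using assms
proof induction
  case (wiener_cos m)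
  have "(real p * \<kappa> * \<sigma>)\<^sup>2 \<le> (real m * \<kappa> * \<sigma>)\<^sup>2"
    using wiener_cos by (simp add: power_mult_distrib mult_right_mono power_mono)
  then have "wiener \<kappa> p (exp (- (real p * \<kappa> * \<sigma>)\<^sup>2 / 2) * 1)
      (\<lambda>x. exp (- (real m * \<kappa> * \<sigma>)\<^sup>2 / 2) * cos (real m * \<kappa> * x))"
    using wiener_cos by (intro wiener_scale[OF wiener.wiener_cos]) auto
  moreover have "smooth \<sigma> (\<lambda>x. cos (real m * \<kappa> * x)) =
      (\<lambda>x. exp (- (real m * \<kappa> * \<sigma>)\<^sup>2 / 2) * cos (real m * \<kappa> * x))"
    by (rule ext) (rule smooth_cos)
  ultimately show ?case by simp
next
  case (wiener_scale M f c M')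
  have "smooth \<sigma> (\<lambda>x. c * f x) = (\<lambda>x. c * smooth \<sigma> f x)"
    by (rule ext) (rule smooth_scale)
  then show ?case
    using wiener_scale by (auto intro!: wiener.wiener_scale[OF wiener_scale.IH] simp: mult.left_commute)
next
  case (wiener_sums M f M' g)
  let ?e = "exp (- (real p * \<kappa> * \<sigma>)\<^sup>2 / 2)"
  show ?case
  proof (rule wiener.wiener_sums[OF wiener_sums.IH])
    show "summable (\<lambda>i. ?e * M i)" by (intro summable_mult wiener_sums)
    show "(\<Sum>i. ?e * M i) \<le> ?e * M'" using wiener_sums.hyps by (simp add: suminf_mult)
    fix x
    \<comment> \<open>The bounds \<open>M i\<close> are uniform in the argument and summable, which
      justifies exchanging series and integral.\<close>
    have "norm (f i y) \<le> M i" for i y using wiener_abs_le[OF wiener_sums.hyps(1)] by simp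
    moreover from this have "(\<integral>z. norm (f i (x + z)) \<partial>gauss \<sigma>) \<le> M i" for i
      by (intro integral_le_const integrable_norm integrable_wiener[OF wiener_sums.hyps(1)]) auto
    ultimately have "(\<lambda>i. \<integral>z. f i (x + z) \<partial>gauss \<sigma>) sums (\<integral>z. (\<Sum>i. f i (x + z)) \<partial>gauss \<sigma>)"
      by (intro sums_integral integrable_wiener[OF wiener_sums.hyps(1)] AE_I2
            summable_comparison_test'[OF wiener_sums.hyps(2)]) auto
    moreover have "(\<Sum>i. f i y) = g y" for y using wiener_sums.hyps(4) sums_unique by metis
    ultimately show "(\<lambda>i. smooth \<sigma> (f i) x) sums smooth \<sigma> g x" by (simp add: smooth_def)
  qed
qed

end

text \<open>A constant is a cosine series, so the norm bound on the exponential remainder reduces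
  the claim to \<open>\<bar>x\<bar>\<close>.\<close>

lemma exp_minus_linear_abs_le:
  assumes "\<bar>x\<bar> \<le> 1"
  shows "\<bar>exp x - 1 - x\<bar> \<le> (x :: real)\<^sup>2"
proof -
  have "\<bar>exp x - 1 - x\<bar> \<le> exp \<bar>x\<bar> - 1 - \<bar>x\<bar>"
    using wiener_abs_le[OF wiener_exp_remainder[OF wiener_const]] by blast
  moreover have "exp \<bar>x\<bar> \<le> 1 + \<bar>x\<bar> + \<bar>x\<bar>\<^sup>2" using assms by (intro exp_bound) auto
  ultimately show ?thesis by simp
qed

lemma power_minus_linear_le:
  assumes "0 \<le> r" "real n * r \<le> 1"
  shows "(1 + r) ^ n - 1 - n * r \<le> (n * r)\<^sup>2"
proof -
  have "(1 + r) ^ n \<le> exp r ^ n" using assms(1) by (intro power_mono exp_ge_add_one_self) auto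
  also have "\<dots> = exp (n * r)" by (simp flip: exp_of_nat_mult)
  also have "\<dots> \<le> 1 + n * r + (n * r)\<^sup>2" using assms by (intro exp_bound) auto
  finally show ?thesis by simp
qed

section \<open>The renormalisation map near the constant weight\<close>

text \<open>The zero mode of \<open>Q\<close> only rescales the weight. Dividing by one plus this
  mode, which costs a factor of at most 2, also changes the coefficient of \<open>x\<close>; that
  change is moved into \<open>h\<close>, so the linear part \<open>x\<close> stays exact.\<close>

lemma wiener_normalise:
  assumes x: "wiener \<kappa> 1 r x" "r \<le> 1" and Q: "wiener \<kappa> 0 t Q" "t \<le> 1/2"
  obtains A h where "A > 0" "\<And>\<phi>. 1 + x \<phi> + Q \<phi> = A * (1 + x \<phi> + h \<phi>)" "wiener \<kappa> 1 (2 * t) h"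
proof -
  obtain A B h where h: "\<And>\<phi>. Q \<phi> = A + h \<phi>" "\<bar>A\<bar> + B \<le> t" "wiener \<kappa> 1 B h"
    using wiener_split[OF Q(1)] by metis
  have A: "\<bar>A\<bar> \<le> 1/2" using h(2) Q(2) wiener_nonneg[OF h(3)] by linarith
  have "\<bar>1 / (1 + A)\<bar> \<le> 2" using A by (simp add: abs_le_iff field_simps)
  moreover have "B + \<bar>A\<bar> * r \<le> t"
    using h(2) mult_left_mono[OF x(2), of "\<bar>A\<bar>"] by simp
  moreover have "0 \<le> B + \<bar>A\<bar> * r" using wiener_nonneg[OF h(3)] wiener_nonneg[OF x(1)] by simp
  ultimately have "\<bar>1 / (1 + A)\<bar> * (B + \<bar>A\<bar> * r) \<le> 2 * t" by (intro mult_mono) auto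
  moreover have "wiener \<kappa> 1 (B + \<bar>A\<bar> * r) (\<lambda>\<phi>. h \<phi> + (- A) * x \<phi>)"
    by (intro wiener_add h wiener_scale[OF x(1)]) simp
  ultimately have "wiener \<kappa> 1 (2 * t) (\<lambda>\<phi>. 1 / (1 + A) * (h \<phi> + (- A) * x \<phi>))"
    by (intro wiener_scale)
  moreover have "1 + x \<phi> + Q \<phi> = (1 + A) * (1 + x \<phi> + 1 / (1 + A) * (h \<phi> + (- A) * x \<phi>))" for \<phi>
    using A h(1)[of \<phi>] by (simp add: field_simps)
  ultimately show thesis using A by (intro that[of "1 + A"]) auto
qed

primrec rg :: "real \<Rightarrow> nat \<Rightarrow> (real \<Rightarrow> real) \<Rightarrow> nat \<Rightarrow> real \<Rightarrow> real" where
  "rg \<sigma> D w 0 = w"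
| "rg \<sigma> D w (Suc j) = (\<lambda>\<phi>. smooth \<sigma> (rg \<sigma> D w j) \<phi> ^ D)"

context
  fixes \<sigma> \<kappa> q b C :: real and D :: nat
  assumes \<sigma>: "\<sigma> > 0"
    and q_def: "q = exp (- (\<kappa> * \<sigma>)\<^sup>2 / 2)"
    and b_def: "b = D * q" and b: "1 < b"
    and C: "2 \<le> C" "8 * (real D)\<^sup>2 \<le> C * (b\<^sup>2 - b)"
begin

lemma q_bounds: "0 < q" "q \<le> 1" by (simp_all add: q_def)

lemma smooth_perturbation:
  assumes "wiener \<kappa> 1 M h"
  shows "smooth \<sigma> (\<lambda>\<phi>. w * (1 + (\<alpha> * cos (\<kappa> * \<phi>) + h \<phi>))) \<phi> = w * (1 + (q * \<alpha> * cos (\<kappa> * \<phi>) + smooth \<sigma> h \<phi>))"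
proof -
  have c: "wiener \<kappa> 1 \<bar>\<alpha>\<bar> (\<lambda>\<phi>. \<alpha> * cos (\<kappa> * \<phi>))" by (rule wiener_cos1) simp
  show ?thesis
    unfolding smooth_scale[OF \<sigma>] smooth_add[OF \<sigma> wiener_const[where \<kappa>=\<kappa>] wiener_add[OF c assms]]
      smooth_add[OF \<sigma> c assms] smooth_const[OF \<sigma>] smooth_cos[OF \<sigma>] q_def by simp
qed

text \<open>Averaging multiplies the first mode by \<open>q\<close> and the norm of \<open>h\<close>
  by at most \<open>q\<close>; the power \<open>D\<close> turns \<open>q\<close> into
  \<open>b\<close> to first order. The inherited error is at most
  \<open>b * C * \<alpha>\<^sup>2\<close>, the new quadratic one at most
  \<open>8 * D\<^sup>2 * \<alpha>\<^sup>2\<close>. The condition on \<open>C\<close> says that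
  together they fit into \<open>C * (b * \<alpha>)\<^sup>2\<close>, so the form of the weight
  reproduces itself.\<close>

lemma rg_step:
  fixes \<alpha> :: real
  assumes W: "\<And>\<phi>. W \<phi> = w * (1 + (\<alpha> * cos (\<kappa> * \<phi>) + h \<phi>))" "w > 0" "wiener \<kappa> 1 (C * \<alpha>\<^sup>2) h"
    and small: "C * \<bar>\<alpha>\<bar> \<le> 1" "4 * D * \<bar>\<alpha>\<bar> \<le> 1"
  obtains w' h' where "w' > 0" "wiener \<kappa> 1 (C * (b * \<alpha>)\<^sup>2) h'"
    "\<And>\<phi>. smooth \<sigma> W \<phi> ^ D = w' * (1 + (b * \<alpha> * cos (\<kappa> * \<phi>) + h' \<phi>))"
proof -
  define y where "y = (\<lambda>\<phi>. q * \<alpha> * cos (\<kappa> * \<phi>) + smooth \<sigma> h \<phi>)"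
  define r where "r = q * \<bar>\<alpha>\<bar> + q * (C * \<alpha>\<^sup>2)"
  have Kh: "wiener \<kappa> 1 (q * (C * \<alpha>\<^sup>2)) (smooth \<sigma> h)"
    using wiener_smooth[OF \<sigma> W(3)] by (simp add: q_def)
  have y: "wiener \<kappa> 1 r y"
    using wiener_add[OF wiener_cos1[OF order_refl, of \<kappa> "q * \<alpha>"] Kh] q_bounds
    by (simp add: y_def r_def abs_mult)
  have r0: "0 \<le> r" using wiener_nonneg[OF y] .
  \<comment> \<open>Smallness of \<open>\<alpha>\<close> makes the error no larger than the main
    term, whence \<open>r \<le> 2 * \<bar>\<alpha>\<bar>\<close>.\<close>
  have "C * \<alpha>\<^sup>2 \<le> \<bar>\<alpha>\<bar>"
    using mult_right_mono[OF small(1), of "\<bar>\<alpha>\<bar>"] by (simp add: power2_eq_square mult.assoc)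
  then have "q * (C * \<alpha>\<^sup>2) \<le> q * \<bar>\<alpha>\<bar>" using q_bounds by simp
  moreover have "q * \<bar>\<alpha>\<bar> \<le> \<bar>\<alpha>\<bar>" using q_bounds by (simp add: mult_left_le_one_le)
  ultimately have "r \<le> 2 * \<bar>\<alpha>\<bar>" unfolding r_def by linarith
  then have Dr: "D * r \<le> 2 * D * \<bar>\<alpha>\<bar>"
    using mult_left_mono[of r "2 * \<bar>\<alpha>\<bar>" "real D"] by simp
  then have Dr': "D * r \<le> 1/2" using small(2) by linarith
  define t where "t = (D * r)\<^sup>2"
  have t: "t \<le> 1/2" using mult_mono[OF Dr' Dr'] r0 by (simp add: t_def power2_eq_square)
  have t': "2 * t \<le> 8 * (real D)\<^sup>2 * \<alpha>\<^sup>2"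
    using power_mono[OF Dr, of 2] r0 by (simp add: t_def power_mult_distrib mult_ac)
  have Q: "wiener \<kappa> 0 t (\<lambda>\<phi>. (1 + y \<phi>) ^ D - 1 - D * y \<phi>)"
    using wiener_antimono[OF y, of 0] Dr' r0 unfolding t_def
    by (intro wiener_mono[OF wiener_power_remainder power_minus_linear_le]) auto
  have Dy: "wiener \<kappa> 1 (D * r) (\<lambda>\<phi>. D * y \<phi>)" by (rule wiener_scale[OF y]) simp
  have Dr1: "D * r \<le> 1" using Dr' by simp
  obtain A g where g: "A > 0"
    "\<And>\<phi>. 1 + D * y \<phi> + ((1 + y \<phi>) ^ D - 1 - D * y \<phi>) = A * (1 + D * y \<phi> + g \<phi>)" "wiener \<kappa> 1 (2 * t) g"
    by (rule wiener_normalise[OF Dy Dr1 Q t]) (rule that)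
  have "W = (\<lambda>\<phi>. w * (1 + (\<alpha> * cos (\<kappa> * \<phi>) + h \<phi>)))" using W(1) by blast
  then have "smooth \<sigma> W \<phi> = w * (1 + y \<phi>)" for \<phi>
    using smooth_perturbation[OF W(3)] by (simp only: y_def)
  moreover have "(1 + y \<phi>) ^ D = A * (1 + (D * y \<phi> + g \<phi>))" for \<phi> using g(2)[of \<phi>] by (simp add: add.assoc)
  moreover have "D * y \<phi> + g \<phi> = b * \<alpha> * cos (\<kappa> * \<phi>) + (D * smooth \<sigma> h \<phi> + g \<phi>)" for \<phi>
    by (simp add: y_def b_def distrib_left mult.assoc)
  ultimately have "smooth \<sigma> W \<phi> ^ D = w ^ D * A * (1 + (b * \<alpha> * cos (\<kappa> * \<phi>) + (D * smooth \<sigma> h \<phi> + g \<phi>)))" for \<phi>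
    by (simp only: power_mult_distrib mult.assoc)
  moreover have "wiener \<kappa> 1 (C * (b * \<alpha>)\<^sup>2) (\<lambda>\<phi>. D * smooth \<sigma> h \<phi> + g \<phi>)"
  proof (rule wiener_mono)
    show "wiener \<kappa> 1 (D * (q * (C * \<alpha>\<^sup>2)) + 2 * t) (\<lambda>\<phi>. D * smooth \<sigma> h \<phi> + g \<phi>)"
      by (intro wiener_add g wiener_scale[OF Kh]) simp
    have "8 * (real D)\<^sup>2 * \<alpha>\<^sup>2 \<le> C * (b\<^sup>2 - b) * \<alpha>\<^sup>2" by (rule mult_right_mono[OF C(2)]) simp
    with t' show "D * (q * (C * \<alpha>\<^sup>2)) + 2 * t \<le> C * (b * \<alpha>)\<^sup>2"
      by (simp add: b_def power_mult_distrib algebra_simps)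
  qed
  ultimately show thesis using W(2) g(1) by (intro that) auto
qed

text \<open>Since \<open>b > 1\<close>, the couplings grow along the flow, so smallness after the
  last step implies smallness at every earlier one. The initial weight has the required form because
  its exponential remainder, once normalised, has norm at most
  \<open>2 * \<alpha>\<^sup>2\<close>.\<close>

lemma rg_flow:
  fixes \<alpha> :: real
  assumes "C * \<bar>b ^ j * \<alpha>\<bar> \<le> 1" "4 * D * \<bar>b ^ j * \<alpha>\<bar> \<le> 1"
  shows "\<exists>w h. w > 0 \<and> wiener \<kappa> 1 (C * (b ^ j * \<alpha>)\<^sup>2) h \<and>
    (\<forall>\<phi>. rg \<sigma> D (\<lambda>\<phi>. exp (\<alpha> * cos (\<kappa> * \<phi>))) j \<phi> = w * (1 + (b ^ j * \<alpha> * cos (\<kappa> * \<phi>) + h \<phi>)))"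
  using assms
proof (induction j)
  case 0
  have a: "\<bar>\<alpha>\<bar> \<le> 1/2" using 0(1) mult_right_mono[OF C(1), of "\<bar>\<alpha>\<bar>"] by simp
  have "exp \<bar>\<alpha>\<bar> - 1 - \<bar>\<alpha>\<bar> \<le> \<alpha>\<^sup>2" using exp_minus_linear_abs_le[of "\<bar>\<alpha>\<bar>"] a by simp
  then have Q: "wiener \<kappa> 0 (\<alpha>\<^sup>2) (\<lambda>\<phi>. exp (\<alpha> * cos (\<kappa> * \<phi>)) - 1 - \<alpha> * cos (\<kappa> * \<phi>))"
    by (intro wiener_mono[OF wiener_exp_remainder[OF wiener_cos1]]) auto
  have a2: "\<alpha>\<^sup>2 \<le> 1/2" using mult_mono[OF a a] by (simp add: power2_eq_square flip: abs_mult)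
  have a1: "\<bar>\<alpha>\<bar> \<le> 1" using a by simp
  obtain A h where h: "A > 0"
    "\<And>\<phi>. 1 + \<alpha> * cos (\<kappa> * \<phi>) + (exp (\<alpha> * cos (\<kappa> * \<phi>)) - 1 - \<alpha> * cos (\<kappa> * \<phi>)) =
       A * (1 + \<alpha> * cos (\<kappa> * \<phi>) + h \<phi>)" "wiener \<kappa> 1 (2 * \<alpha>\<^sup>2) h"
    by (rule wiener_normalise[OF wiener_cos1[OF order_refl, of \<kappa> \<alpha>] a1 Q a2]) (rule that)
  have "wiener \<kappa> 1 (C * \<alpha>\<^sup>2) h"
    by (rule wiener_mono[OF h(3)]) (simp add: mult_right_mono C)
  with h(1,2) show ?case by (intro exI[of _ A] exI[of _ h]) (simp add: add.assoc)
next
  case (Suc j)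
  have le: "\<bar>b ^ j * \<alpha>\<bar> \<le> \<bar>b ^ Suc j * \<alpha>\<bar>"
    using b mult_right_mono[of 1 b "\<bar>b ^ j * \<alpha>\<bar>"] by (simp add: abs_mult)
  have small: "C * \<bar>b ^ j * \<alpha>\<bar> \<le> 1" "4 * D * \<bar>b ^ j * \<alpha>\<bar> \<le> 1"
    using Suc.prems mult_left_mono[OF le, of C] mult_left_mono[OF le, of "4 * D"] C(1) by linarith+
  from Suc.IH[OF this] obtain w h where *: "w > 0" "wiener \<kappa> 1 (C * (b ^ j * \<alpha>)\<^sup>2) h"
    "\<And>\<phi>. rg \<sigma> D (\<lambda>\<phi>. exp (\<alpha> * cos (\<kappa> * \<phi>))) j \<phi> = w * (1 + (b ^ j * \<alpha> * cos (\<kappa> * \<phi>) + h \<phi>))"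
    by blast
  obtain w' h' where "w' > 0" "wiener \<kappa> 1 (C * (b * (b ^ j * \<alpha>))\<^sup>2) h'"
    "\<And>\<phi>. smooth \<sigma> (rg \<sigma> D (\<lambda>\<phi>. exp (\<alpha> * cos (\<kappa> * \<phi>))) j) \<phi> ^ D =
       w' * (1 + (b * (b ^ j * \<alpha>) * cos (\<kappa> * \<phi>) + h' \<phi>))"
    by (rule rg_step[OF *(3,1,2) small]) (rule that)
  then show ?case by (intro exI[of _ w'] exI[of _ h']) (simp add: mult.assoc)
qed

end

text \<open>
  The gain \<open>(1 - q\<^sup>2)\<^sup>2 / 8\<close> is a quarter of the minimum over \<open>\<phi>\<close> of the variance of
  \<open>cos (\<kappa> * (\<phi> + z))\<close>; the losses absorb \<open>h\<close> and the normalisation of \<open>W\<close>.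
\<close>

lemma cos_tilt:
  fixes \<sigma> \<kappa> q \<alpha> \<tau> :: real
  assumes \<sigma>: "\<sigma> > 0" and q_def: "q = exp (- (\<kappa> * \<sigma>)\<^sup>2 / 2)"
    and W: "\<And>\<phi>. W \<phi> = w * (1 + (\<alpha> * cos (\<kappa> * \<phi>) + h \<phi>))" "w > 0" "wiener \<kappa> 1 M h"
    and small: "8 * M \<le> (1 - q\<^sup>2)\<^sup>2 * \<bar>\<alpha>\<bar>" "\<bar>\<alpha>\<bar> + M \<le> 1/2"
    and \<tau>: "\<bar>\<tau>\<bar> \<le> 1/2" "\<tau> * \<alpha> = - (\<bar>\<tau>\<bar> * \<bar>\<alpha>\<bar>)"
  shows "(\<integral>z. W (\<phi> + z) * exp (\<tau> * (cos (\<kappa> * (\<phi> + z)) - q * cos (\<kappa> * \<phi>))) \<partial>gauss \<sigma>)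
    \<le> exp (4 * \<tau>\<^sup>2 - (1 - q\<^sup>2)\<^sup>2 / 8 * \<bar>\<tau>\<bar> * \<bar>\<alpha>\<bar>) * smooth \<sigma> W \<phi>"
proof -
  interpret prob_space "gauss \<sigma>" using \<sigma> by (rule prob_space_normal_density)
  define c where "c = (\<lambda>z. cos (\<kappa> * (\<phi> + z)))"
  define c0 where "c0 = cos (\<kappa> * \<phi>)"
  define \<xi> where "\<xi> = (\<lambda>z. c z - q * c0)"
  define u where "u = (\<lambda>z. 1 + (\<alpha> * c z + h (\<phi> + z)))"
  define m where "m = (\<integral>z. u z \<partial>gauss \<sigma>)"
  define V where "V = (\<integral>z. c z * \<xi> z \<partial>gauss \<sigma>)"
  have q: "0 < q" "q \<le> 1" by (simp_all add: q_def)
  have meas [measurable]: "h \<in> borel_measurable borel" using wiener_measurable[OF W(3)] .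
  have cb: "\<bar>c z\<bar> \<le> 1" "\<bar>c0\<bar> \<le> 1" for z by (simp_all add: c_def c0_def)
  have hb: "\<bar>h z\<bar> \<le> M" for z using wiener_abs_le[OF W(3)] .
  have xb: "\<bar>\<xi> z\<bar> \<le> 2" for z
  proof -
    have "\<bar>q * c0\<bar> \<le> 1" using mult_mono[of q 1 "\<bar>c0\<bar>" 1] q cb by (simp add: abs_mult)
    then show ?thesis using cb(1)[of z] unfolding \<xi>_def by linarith
  qed
  have ub: "1/2 \<le> u z" "u z \<le> 3/2" for z
  proof -
    have "\<bar>\<alpha> * c z\<bar> \<le> \<bar>\<alpha>\<bar>" using mult_left_mono[OF cb(1)[of z], of "\<bar>\<alpha>\<bar>"] by (simp add: abs_mult)
    then show "1/2 \<le> u z" "u z \<le> 3/2" using hb[of "\<phi> + z"] small(2) unfolding u_def by linarith+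
  qed
  have M0: "0 \<le> M" using wiener_nonneg[OF W(3)] .
  have [measurable]: "c \<in> borel_measurable borel" "\<xi> \<in> borel_measurable borel" "u \<in> borel_measurable borel"
    unfolding c_def \<xi>_def u_def by measurable
  have int: "integrable (gauss \<sigma>) f" if "f \<in> borel_measurable borel" "\<And>z. \<bar>f z\<bar> \<le> B" for f :: "real \<Rightarrow> real" and B
    using that by (intro integrable_const_bound[of _ B]) auto
  have int': "integrable (gauss \<sigma>) (\<lambda>z. f z * g z)"
    if "f \<in> borel_measurable borel" "g \<in> borel_measurable borel" "\<And>z. \<bar>f z\<bar> \<le> B" "\<And>z. \<bar>g z\<bar> \<le> B'"
    for f g :: "real \<Rightarrow> real" and B B'
  proof (rule int)
    show "\<bar>f z * g z\<bar> \<le> B * B'" for z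
      using that(3)[of z] that(4)[of z] unfolding abs_mult by (intro mult_mono) auto
  qed (use that in measurable)
  have ub': "\<bar>u z\<bar> \<le> 3/2" for z using ub[of z] by simp
  note ints = int[OF _ cb(1)] int[OF _ xb] int[OF _ ub'] int'[OF _ _ cb(1) xb] int'[OF _ _ ub' xb]
    int'[OF _ _ cb(1) cb(1)]
  have hint: "integrable (gauss \<sigma>) (\<lambda>z. h (\<phi> + z) * \<xi> z)"
    by (rule int'[of _ _ M 2]) (auto simp: hb xb)
  have Ec: "(\<integral>z. c z \<partial>gauss \<sigma>) = q * c0"
    unfolding c_def c0_def q_def by (rule integral_gauss_cos[OF \<sigma>])
  have E\<xi>: "(\<integral>z. \<xi> z \<partial>gauss \<sigma>) = 0"
    unfolding \<xi>_def using prob_space by (subst Bochner_Integration.integral_diff) (auto simp: Ec ints)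
  \<comment> \<open>The squared cosine contains the doubled frequency, whose damping factor is the
    fourth power of \<open>q\<close>.\<close>
  have q4: "exp (- (2 * \<kappa> * \<sigma>)\<^sup>2 / 2) = q ^ 4"
    by (simp add: q_def power_mult_distrib flip: exp_of_nat_mult)
  have Ecc: "(\<integral>z. c z * c z \<partial>gauss \<sigma>) = 1/2 + q ^ 4 * (c0\<^sup>2 - 1/2)"
  proof -
    have "cos (2 * \<kappa> * (\<phi> + z)) = 2 * (c z * c z) - 1" for z
      using cos_double_cos[of "\<kappa> * (\<phi> + z)"] by (simp add: c_def power2_eq_square mult.assoc)
    then have "c z * c z = 1/2 + 1/2 * cos (2 * \<kappa> * (\<phi> + z))" for z
      by (simp add: diff_divide_distrib)
    then have "(\<integral>z. c z * c z \<partial>gauss \<sigma>) = (\<integral>z. 1/2 + 1/2 * cos (2 * \<kappa> * (\<phi> + z)) \<partial>gauss \<sigma>)"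
      by presburger
    also have "\<dots> = 1/2 + 1/2 * (\<integral>z. cos (2 * \<kappa> * (\<phi> + z)) \<partial>gauss \<sigma>)"
    proof -
      have "integrable (gauss \<sigma>) (\<lambda>z. cos (2 * \<kappa> * (\<phi> + z)))" by (rule int[of _ 1]) auto
      then show ?thesis using prob_space by (subst Bochner_Integration.integral_add) auto
    qed
    also have "\<dots> = 1/2 + 1/2 * (q ^ 4 * cos (2 * \<kappa> * \<phi>))"
      unfolding integral_gauss_cos[OF \<sigma>] q4 ..
    also have "cos (2 * \<kappa> * \<phi>) = 2 * c0\<^sup>2 - 1"
      using cos_double_cos[of "\<kappa> * \<phi>"] by (simp add: c0_def mult.assoc)
    finally show ?thesis by (simp add: algebra_simps)
  qed
  have "V = (\<integral>z. c z * c z - q * c0 * c z \<partial>gauss \<sigma>)"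
    unfolding V_def \<xi>_def by (simp add: algebra_simps)
  also have "\<dots> = 1/2 + q ^ 4 * (c0\<^sup>2 - 1/2) - q * c0 * (q * c0)"
    by (subst Bochner_Integration.integral_diff) (auto simp: Ec Ecc ints)
  \<comment> \<open>\<open>V\<close> is the variance of \<open>c\<close>. In this form its minimum
    is visible: the second term is nonnegative and vanishes where
    \<open>c0\<^sup>2 = 1\<close>.\<close>
  finally have V: "V = (1 - q\<^sup>2)\<^sup>2 / 2 + q\<^sup>2 * (1 - q\<^sup>2) * (1 - c0\<^sup>2)"
    by (simp add: power2_eq_square power4_eq_xxxx field_simps)
  have "c0\<^sup>2 \<le> 1" "q\<^sup>2 \<le> 1" using cb(2) q by (simp_all add: abs_square_le_1 power_le_one)
  then have V: "(1 - q\<^sup>2)\<^sup>2 / 2 \<le> V" unfolding V by simp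
  \<comment> \<open>The constant part of \<open>u\<close> drops out because \<open>\<xi>\<close> is
    centred, the cosine part gives \<open>\<alpha> * V\<close>, and \<open>h\<close> contributes at
    most \<open>2 * M\<close> because \<open>\<bar>\<xi> z\<bar> \<le> 2\<close>.\<close>
  have Eu\<xi>: "\<bar>(\<integral>z. u z * \<xi> z \<partial>gauss \<sigma>) - \<alpha> * V\<bar> \<le> 2 * M"
  proof -
    have "(\<integral>z. u z * \<xi> z \<partial>gauss \<sigma>) = (\<integral>z. \<xi> z + (\<alpha> * (c z * \<xi> z) + h (\<phi> + z) * \<xi> z) \<partial>gauss \<sigma>)"
      unfolding u_def by (simp add: algebra_simps)
    also have "\<dots> = \<alpha> * V + (\<integral>z. h (\<phi> + z) * \<xi> z \<partial>gauss \<sigma>)"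
      unfolding V_def by (simp add: E\<xi> ints hint)
    finally have "\<bar>(\<integral>z. u z * \<xi> z \<partial>gauss \<sigma>) - \<alpha> * V\<bar> = \<bar>\<integral>z. h (\<phi> + z) * \<xi> z \<partial>gauss \<sigma>\<bar>" by simp
    also have "\<dots> \<le> (\<integral>z. \<bar>h (\<phi> + z) * \<xi> z\<bar> \<partial>gauss \<sigma>)" by (rule integral_abs_bound)
    also have "\<dots> \<le> M * 2"
    proof (rule integral_le_const)
      have "\<bar>h (\<phi> + z)\<bar> * \<bar>\<xi> z\<bar> \<le> M * 2" for z by (intro mult_mono hb xb M0) simp
      then show "AE z in gauss \<sigma>. \<bar>h (\<phi> + z) * \<xi> z\<bar> \<le> M * 2" by (simp add: abs_mult)
    qed (simp add: hint)
    finally show ?thesis by simp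
  qed
  have m: "1/2 \<le> m" "m \<le> 3/2"
    unfolding m_def by (auto intro!: integral_ge_const integral_le_const ints AE_I2 ub simp del: divide_le_eq le_divide_eq le_divide_eq_numeral1 divide_le_eq_numeral1)
  have K: "smooth \<sigma> W \<phi> = w * m"
    by (simp add: smooth_def W(1) m_def u_def c_def)
  have I: "(\<integral>z. W (\<phi> + z) * exp (\<tau> * (cos (\<kappa> * (\<phi> + z)) - q * cos (\<kappa> * \<phi>))) \<partial>gauss \<sigma>)
      = w * (\<integral>z. u z * exp (\<tau> * \<xi> z) \<partial>gauss \<sigma>)"
    by (simp add: W(1) u_def c_def \<xi>_def c0_def mult.assoc)
  \<comment> \<open>Second-order expansion of the tilt, valid since
    \<open>\<bar>\<tau> * \<xi> z\<bar> \<le> 1\<close>; positivity of \<open>u\<close> allows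
    integrating the bound against it.\<close>
  have "(\<integral>z. u z * exp (\<tau> * \<xi> z) \<partial>gauss \<sigma>) \<le> (\<integral>z. (1 + 4 * \<tau>\<^sup>2) * u z + \<tau> * (u z * \<xi> z) \<partial>gauss \<sigma>)"
  proof (rule integral_mono)
    have tx: "\<bar>\<tau> * \<xi> z\<bar> \<le> 1" for z
      using mult_mono[OF \<tau>(1) xb[of z]] by (simp add: abs_mult)
    show "integrable (gauss \<sigma>) (\<lambda>z. u z * exp (\<tau> * \<xi> z))"
    proof (rule int'[OF _ _ ub'])
      show "\<bar>exp (\<tau> * \<xi> z)\<bar> \<le> exp 1" for z using tx[of z] by simp
    qed measurable
    show "integrable (gauss \<sigma>) (\<lambda>z. (1 + 4 * \<tau>\<^sup>2) * u z + \<tau> * (u z * \<xi> z))"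
      by (simp add: ints)
    fix z
    have "exp (\<tau> * \<xi> z) \<le> 1 + \<tau> * \<xi> z + (\<tau> * \<xi> z)\<^sup>2"
      using exp_minus_linear_abs_le[OF tx[of z]] by linarith
    moreover have "(\<tau> * \<xi> z)\<^sup>2 \<le> 4 * \<tau>\<^sup>2"
      using mult_left_mono[OF power_mono[OF xb[of z], of 2], of "\<tau>\<^sup>2"] by (simp add: power_mult_distrib)
    ultimately have "exp (\<tau> * \<xi> z) \<le> 1 + 4 * \<tau>\<^sup>2 + \<tau> * \<xi> z" by linarith
    from mult_left_mono[OF this, of "u z"] ub(1)[of z]
    show "u z * exp (\<tau> * \<xi> z) \<le> (1 + 4 * \<tau>\<^sup>2) * u z + \<tau> * (u z * \<xi> z)"
      by (simp add: algebra_simps)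
  qed
  also have "\<dots> = (1 + 4 * \<tau>\<^sup>2) * m + \<tau> * (\<integral>z. u z * \<xi> z \<partial>gauss \<sigma>)"
  proof -
    have u: "integrable (gauss \<sigma>) u" by (rule int[OF _ ub']) measurable
    have ux: "integrable (gauss \<sigma>) (\<lambda>z. u z * \<xi> z)" by (rule int'[OF _ _ ub' xb]) measurable
    have "(\<integral>z. (1 + 4 * \<tau>\<^sup>2) * u z + \<tau> * (u z * \<xi> z) \<partial>gauss \<sigma>) =
        (\<integral>z. (1 + 4 * \<tau>\<^sup>2) * u z \<partial>gauss \<sigma>) + (\<integral>z. \<tau> * (u z * \<xi> z) \<partial>gauss \<sigma>)"
      by (intro Bochner_Integration.integral_add integrable_mult_right u ux)
    then show ?thesis by (simp only: m_def integral_mult_right_zero)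
  qed
  also have "\<dots> \<le> m * (1 + (4 * \<tau>\<^sup>2 - (1 - q\<^sup>2)\<^sup>2 / 8 * \<bar>\<tau>\<bar> * \<bar>\<alpha>\<bar>))"
  proof -
    let ?I = "\<integral>z. u z * \<xi> z \<partial>gauss \<sigma>"
    have "\<tau> * (?I - \<alpha> * V) \<le> \<bar>\<tau>\<bar> * (2 * M)"
      using mult_left_mono[OF Eu\<xi>, of "\<bar>\<tau>\<bar>"] unfolding abs_mult[symmetric] by linarith
    then have "\<tau> * ?I \<le> \<bar>\<tau>\<bar> * (2 * M) + \<tau> * \<alpha> * V" by (simp add: algebra_simps)
    also have "\<dots> = \<bar>\<tau>\<bar> * (2 * M - \<bar>\<alpha>\<bar> * V)" unfolding \<tau>(2) by (simp add: algebra_simps)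
    \<comment> \<open>Half of the lower bound on \<open>V\<close> pays for \<open>2 * M\<close>. In
      the next step \<open>m \<le> 2\<close> costs another factor 2, which leaves the constant
      \<open>1/8\<close>.\<close>
    also have "\<dots> \<le> \<bar>\<tau>\<bar> * (- (\<bar>\<alpha>\<bar> * ((1 - q\<^sup>2)\<^sup>2 / 4)))"
      using small(1) mult_left_mono[OF V, of "\<bar>\<alpha>\<bar>"] by (intro mult_left_mono) (auto simp: algebra_simps)
    also have "\<dots> \<le> - (m * ((1 - q\<^sup>2)\<^sup>2 / 8 * \<bar>\<tau>\<bar> * \<bar>\<alpha>\<bar>))"
      using mult_right_mono[of m 2 "(1 - q\<^sup>2)\<^sup>2 / 8 * \<bar>\<tau>\<bar> * \<bar>\<alpha>\<bar>"] m(2)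
      by (simp add: mult_ac)
    finally show ?thesis by (simp add: algebra_simps)
  qed
  also have "\<dots> \<le> m * exp (4 * \<tau>\<^sup>2 - (1 - q\<^sup>2)\<^sup>2 / 8 * \<bar>\<tau>\<bar> * \<bar>\<alpha>\<bar>)"
    using m(1) by (intro mult_left_mono exp_ge_add_one_self) auto
  finally have "w * (\<integral>z. u z * exp (\<tau> * \<xi> z) \<partial>gauss \<sigma>) \<le>
      w * (m * exp (4 * \<tau>\<^sup>2 - (1 - q\<^sup>2)\<^sup>2 / 8 * \<bar>\<tau>\<bar> * \<bar>\<alpha>\<bar>))"
    using W(2) by (intro mult_left_mono) auto
  then show ?thesis unfolding I K by (simp only: mult_ac)
qed

section \<open>Singularity from exponential moments\<close>

text \<open>The first bound makes the sum of the \<open>f n\<close> finite almost surely under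
  \<open>P\<close>, the second that of the reciprocals under \<open>G\<close>. Both sums cannot be
  finite at the same point, since a positive number and its reciprocal add up to at least 1.\<close>

lemma mutually_singularI_nn_integral:
  fixes f :: "nat \<Rightarrow> 'a \<Rightarrow> real"
  assumes sets: "sets P = sets G" and meas: "\<And>n. f n \<in> borel_measurable G"
    and pos: "\<And>n x. 0 < f n x" and r: "0 \<le> r" "r < 1"
    and P: "\<And>n. (\<integral>\<^sup>+x. f n x \<partial>P) \<le> ennreal (r ^ n)"
    and G: "\<And>n. (\<integral>\<^sup>+x. 1 / f n x \<partial>G) \<le> ennreal (r ^ n)"
  shows "mutually_singular P G"
proof -
  have fin: "AE x in M. (\<Sum>n. ennreal (g n x)) < top"
    if g: "\<And>n. g n \<in> borel_measurable M" "\<And>n. (\<integral>\<^sup>+x. g n x \<partial>M) \<le> ennreal (r ^ n)"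
    for g :: "nat \<Rightarrow> 'a \<Rightarrow> real" and M :: "'a measure"
  proof -
    have "(\<integral>\<^sup>+x. (\<Sum>n. ennreal (g n x)) \<partial>M) = (\<Sum>n. \<integral>\<^sup>+x. g n x \<partial>M)"
      using g(1) by (intro nn_integral_suminf) simp
    also have "\<dots> \<le> (\<Sum>n. ennreal (r ^ n))" by (intro suminf_le g(2)) auto
    also have "\<dots> < top"
      using r by (simp add: less_top[symmetric] ennreal_suminf_neq_top summable_geometric)
    finally have "(\<integral>\<^sup>+x. (\<Sum>n. ennreal (g n x)) \<partial>M) \<noteq> \<infinity>" by simp
    moreover have "(\<lambda>x. \<Sum>n. ennreal (g n x)) \<in> borel_measurable M" using g(1) by measurable
    ultimately have "AE x in M. (\<Sum>n. ennreal (g n x)) \<noteq> \<infinity>" by (intro nn_integral_PInf_AE)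
    then show ?thesis by (simp add: less_top)
  qed
  have meas': "f n \<in> borel_measurable P" for n
    unfolding measurable_cong_sets[OF sets refl] by (rule meas)
  note [measurable] = meas
  \<comment> \<open>The separating set: it has full measure under \<open>G\<close> and is null under
    \<open>P\<close>.\<close>
  define A where "A = {x \<in> space G. (\<Sum>n. ennreal (1 / f n x)) < top}"
  have A: "A \<in> sets G" unfolding A_def by measurable
  have "(\<Sum>n. ennreal (1 / f n x)) = top" if "(\<Sum>n. ennreal (f n x)) < top" for x
  proof (rule ccontr)
    assume "(\<Sum>n. ennreal (1 / f n x)) \<noteq> top"
    with that have "(\<Sum>n. ennreal (f n x) + ennreal (1 / f n x)) < top"
      by (subst suminf_add[symmetric]) (auto simp: less_top)
    moreover have "1 \<le> ennreal (f n x) + ennreal (1 / f n x)" for n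
    proof -
      have "1 \<le> f n x + 1 / f n x"
        using pos[of n x] by (cases "1 \<le> f n x") (simp_all add: add_increasing add_increasing2)
      then have "ennreal 1 \<le> ennreal (f n x + 1 / f n x)" by (rule ennreal_leI)
      then show ?thesis using pos[of n x] by (simp add: ennreal_plus less_imp_le)
    qed
    then have "(\<Sum>n::nat. 1 :: ennreal) \<le> (\<Sum>n. ennreal (f n x) + ennreal (1 / f n x))"
      by (intro suminf_le) auto
    moreover have "(\<Sum>n::nat. 1 :: ennreal) = top" by (simp add: suminf_eq_SUP ennreal_SUP_of_nat_eq_top)
    ultimately show False by (simp add: top_unique)
  qed
  with fin[OF meas' P] have "AE x in P. x \<notin> A" by (auto simp: A_def)
  then have "A \<in> null_sets P" using A sets AE_iff_null_sets[of A P] by simp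
  moreover have "AE x in G. (\<Sum>n. ennreal (1 / f n x)) < top" by (rule fin[OF _ G]) measurable
  then have "AE x in G. x \<notin> space G - A" by (auto simp: A_def)
  then have "space G - A \<in> null_sets G" using A AE_iff_null_sets[of "space G - A" G] by simp
  ultimately show ?thesis using A sets by (auto simp: mutually_singular_def)
qed

section \<open>Integrating out a layer\<close>

definition parent :: "nat \<Rightarrow> int \<times> int \<Rightarrow> int \<times> int" where
  "parent L x = (fst x div int L, snd x div int L)"

text \<open>The field as a recursion along the ancestors of a site, so that the newest layer splits
  off by unfolding.\<close>

primrec int_field :: "nat \<Rightarrow> nat \<Rightarrow> (nat \<times> int \<times> int \<Rightarrow> real) \<Rightarrow> int \<times> int \<Rightarrow> real" where
  "int_field L 0 \<omega> x = \<omega> (0, x)"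
| "int_field L (Suc n) \<omega> x = int_field L n \<omega> (parent L x) + \<omega> (Suc n, x)"

lemma finite_Lam [simp, intro]: "finite (Lam L n)"
  by (simp add: Lam_def)

lemma card_Lam: "card (Lam L n) = L ^ (2 * n)"
  by (simp add: Lam_def card_cartesian_product power_add mult_2 nat_power_eq)

lemma layers_upto_Suc: "layers_upto L (Suc n) = layers_upto L n \<union> {Suc n} \<times> Lam L (Suc n)"
  by (auto simp: layers_upto_def le_Suc_eq)

lemma finite_layers_upto [simp, intro]: "finite (layers_upto L n)"
  by (auto simp: layers_upto_def)

lemma floor_level:
  assumes "L > 0" "k \<le> n"
  shows "\<lfloor>real L ^ k * (real_of_int i / real L ^ n)\<rfloor> = i div int L ^ (n - k)"
proof -
  have "real L ^ n = real L ^ k * real L ^ (n - k)" using assms(2) by (simp flip: power_add)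
  then have "real L ^ k * (real_of_int i / real L ^ n) = real_of_int i / real_of_int (int L ^ (n - k))"
    using assms(1) by simp
  then show ?thesis by (simp only: floor_divide_of_int_eq)
qed

text \<open>The integer part at level \<open>k\<close> of a site of level \<open>n\<close> is its
  ancestor there, and iterated division by \<open>L\<close> is division by a power of
  \<open>L\<close>.\<close>

lemma hfield_eq_int_field:
  assumes "L > 0"
  shows "hfield L n \<omega> (real_of_int i / real L ^ n, real_of_int j / real L ^ n) = int_field L n \<omega> (i, j)"
proof -
  have "(\<Sum>k=0..n. \<omega> (k, (i div int L ^ (n - k), j div int L ^ (n - k)))) = int_field L n \<omega> (i, j)"
  proof (induction n arbitrary: i j)
    case (Suc n)
    have "i div int L div int L ^ (n - k) = i div int L ^ (Suc n - k)" if "k \<le> n" for i k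
      using that by (simp add: Suc_diff_le div_mult2_eq' flip: zdiv_zmult2_eq)
    then show ?case using Suc[of "i div int L" "j div int L"] by (simp add: parent_def)
  qed simp
  then show ?thesis using assms by (simp add: hfield_def floor_level del: times_divide_eq_right)
qed

lemma sum_barLam:
  assumes "L > 0"
  shows "(\<Sum>x\<in>barLam L n. f (hfield L n \<omega> x)) = (\<Sum>x\<in>Lam L n. f (int_field L n \<omega> x))"
proof -
  have "inj_on (\<lambda>(i, j). (real_of_int i / real L ^ n, real_of_int j / real L ^ n)) (Lam L n)"
    using assms by (auto simp: inj_on_def)
  then show ?thesis using assms
    by (simp add: barLam_def sum.reindex) (auto intro!: sum.cong simp: hfield_eq_int_field)
qed

lemma div_eq_iff_int:
  fixes i k l :: int
  assumes "0 < l"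
  shows "i div l = k \<longleftrightarrow> k * l \<le> i \<and> i < k * l + l"
proof
  assume "i div l = k"
  then have "i = l * k + i mod l" by (metis mult_div_mod_eq)
  then show "k * l \<le> i \<and> i < k * l + l"
    using pos_mod_bound[OF assms, of i] pos_mod_sign[OF assms, of i] by (simp add: mult.commute)
next
  assume "k * l \<le> i \<and> i < k * l + l"
  then show "i div l = k" by (intro int_div_pos_eq[of _ _ _ "i - k * l"]) auto
qed

context
  fixes L :: nat
  assumes L: "0 < L"
begin

lemma parent_fibre:
  "parent L x = y \<longleftrightarrow> x \<in> {fst y * int L..<fst y * int L + int L} \<times> {snd y * int L..<snd y * int L + int L}"
  using L by (auto simp: parent_def div_eq_iff_int prod_eq_iff mem_Times_iff)

lemma Lam_Suc: "x \<in> Lam L (Suc n) \<longleftrightarrow> parent L x \<in> Lam L n"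
proof -
  have "0 \<le> i \<and> i < int L * int L ^ n \<longleftrightarrow> 0 \<le> i div int L \<and> i div int L < int L ^ n" for i
  proof -
    have *: "i div int L * int L \<le> i" "i < (i div int L + 1) * int L"
      using div_eq_iff_int[of "int L" i "i div int L"] L by (simp_all add: distrib_right)
    have "i < int L ^ n * int L \<longleftrightarrow> i div int L < int L ^ n"
    proof
      assume "i < int L ^ n * int L"
      with *(1) have "i div int L * int L < int L ^ n * int L" by linarith
      then show "i div int L < int L ^ n" using L by simp
    next
      assume "i div int L < int L ^ n"
      then have "(i div int L + 1) * int L \<le> int L ^ n * int L" by (intro mult_right_mono) auto
      with *(2) show "i < int L ^ n * int L" by linarith
    qed
    then show ?thesis using L by (simp add: pos_imp_zdiv_nonneg_iff mult.commute)
  qed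
  then show ?thesis by (auto simp: Lam_def parent_def mem_Times_iff)
qed

text \<open>The children of a site form an \<open>L\<close> by \<open>L\<close> square, and every
  site of the finer level has its parent in the coarser box.\<close>

lemma prod_Lam_Suc:
  fixes H :: "int \<times> int \<Rightarrow> 'a :: comm_monoid_mult"
  shows "(\<Prod>x\<in>Lam L (Suc n). H (parent L x)) = (\<Prod>y\<in>Lam L n. H y ^ L\<^sup>2)"
proof -
  have "(\<Prod>x\<in>Lam L (Suc n). H (parent L x)) =
      (\<Prod>y\<in>Lam L n. \<Prod>x | x \<in> Lam L (Suc n) \<and> parent L x = y. H (parent L x))"
    by (rule prod.group[symmetric]) (auto simp: Lam_Suc)
  also have "\<dots> = (\<Prod>y\<in>Lam L n. H y ^ L\<^sup>2)"
  proof (rule prod.cong)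
    fix y assume y: "y \<in> Lam L n"
    have "{x. x \<in> Lam L (Suc n) \<and> parent L x = y} = {x. parent L x = y}"
      using y by (auto simp: Lam_Suc)
    also have "\<dots> = {fst y * int L..<fst y * int L + int L} \<times> {snd y * int L..<snd y * int L + int L}"
      using parent_fibre by blast
    finally have "card {x. x \<in> Lam L (Suc n) \<and> parent L x = y} = L\<^sup>2"
      by (simp add: card_cartesian_product power2_eq_square)
    moreover have "(\<Prod>x | x \<in> Lam L (Suc n) \<and> parent L x = y. H (parent L x)) =
        (\<Prod>x | x \<in> Lam L (Suc n) \<and> parent L x = y. H y)"
      by (rule prod.cong) auto
    ultimately show "(\<Prod>x | x \<in> Lam L (Suc n) \<and> parent L x = y. H (parent L x)) = H y ^ L\<^sup>2"
      by simp
  qed simp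
  finally show ?thesis .
qed

lemma int_field_cong:
  assumes "\<And>k y. k \<le> n \<Longrightarrow> y \<in> Lam L k \<Longrightarrow> \<omega> (k, y) = \<omega>' (k, y)" "x \<in> Lam L n"
  shows "int_field L n \<omega> x = int_field L n \<omega>' x"
  using assms
proof (induction n arbitrary: x)
  case (Suc n)
  then show ?case using Suc.IH[of "parent L x"] by (simp add: Lam_Suc)
qed simp

lemma int_field_restrict:
  "x \<in> Lam L m \<Longrightarrow> m \<le> n \<Longrightarrow> int_field L m (restrict \<omega> (layers_upto L n)) x = int_field L m \<omega> x"
  by (rule int_field_cong) (auto simp: layers_upto_def)

lemma measurable_int_field [measurable (raw)]:
  assumes "x \<in> Lam L m" "layers_upto L m \<subseteq> I"
  shows "(\<lambda>\<omega>. int_field L m \<omega> x) \<in> borel_measurable (PiM I (\<lambda>_. gauss \<sigma>))"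
  using assms
proof (induction m arbitrary: x)
  case (Suc m)
  have [measurable]: "(\<lambda>\<omega>. int_field L m \<omega> (parent L x)) \<in> borel_measurable (PiM I (\<lambda>_. gauss \<sigma>))"
    using Suc by (intro Suc.IH) (auto simp: Lam_Suc layers_upto_def)
  have "(\<lambda>\<omega>. \<omega> (Suc m, x)) \<in> measurable (PiM I (\<lambda>_. gauss \<sigma>)) (gauss \<sigma>)"
    using Suc.prems by (intro measurable_component_singleton) (auto simp: layers_upto_def)
  then have [measurable]: "(\<lambda>\<omega>. \<omega> (Suc m, x)) \<in> borel_measurable (PiM I (\<lambda>_. gauss \<sigma>))"
    by simp
  show ?case by simp
next
  case 0
  then have "(\<lambda>\<omega>. \<omega> (0, x)) \<in> measurable (PiM I (\<lambda>_. gauss \<sigma>)) (gauss \<sigma>)"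
    by (intro measurable_component_singleton) (auto simp: layers_upto_def)
  then show ?case by simp
qed

text \<open>Fubini over the newest layer: given the older layers its variables are independent and
  identically distributed, so the integral factorises over sites. Each factor depends only on the
  parent, and siblings share the same factor, whence the power \<open>L\<^sup>2\<close>.\<close>

lemma nn_integral_layer:
  fixes F :: "(nat \<times> int \<times> int \<Rightarrow> real) \<Rightarrow> ennreal" and H :: "real \<Rightarrow> real \<Rightarrow> ennreal"
  assumes \<sigma>: "0 < \<sigma>"
    and F: "F \<in> borel_measurable (PiM (layers_upto L n) (\<lambda>_. gauss \<sigma>))"
    and H: "(\<lambda>(\<phi>, z). H \<phi> z) \<in> borel_measurable (borel \<Otimes>\<^sub>M borel)"
  shows "(\<integral>\<^sup>+\<omega>. F (restrict \<omega> (layers_upto L n)) *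
        (\<Prod>x\<in>Lam L (Suc n). H (int_field L n \<omega> (parent L x)) (\<omega> (Suc n, x)))
      \<partial>PiM (layers_upto L (Suc n)) (\<lambda>_. gauss \<sigma>)) =
    (\<integral>\<^sup>+\<omega>. F \<omega> * (\<Prod>y\<in>Lam L n. (\<integral>\<^sup>+z. H (int_field L n \<omega> y) z \<partial>gauss \<sigma>) ^ L\<^sup>2)
      \<partial>PiM (layers_upto L n) (\<lambda>_. gauss \<sigma>))"
proof -
  interpret prob_space "gauss \<sigma>" using \<sigma> by (rule prob_space_normal_density)
  interpret product_sigma_finite "\<lambda>_ :: nat \<times> int \<times> int. gauss \<sigma>" by standard
  let ?I = "layers_upto L n" and ?J = "{Suc n} \<times> Lam L (Suc n)"
  let ?M = "\<lambda>I. PiM I (\<lambda>_. gauss \<sigma>)"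
  note F [measurable]
  have H' [measurable]: "(\<lambda>x. H (f x) (g x)) \<in> borel_measurable N"
    if "f \<in> borel_measurable N" "g \<in> borel_measurable N" for f g and N :: "'b measure"
    using measurable_compose[OF measurable_Pair[OF that] H] by simp
  have F' [measurable]: "(\<lambda>\<omega>. F (restrict \<omega> ?I)) \<in> borel_measurable (?M (?I \<union> ?J))"
    by (rule measurable_compose[OF measurable_restrict_subset F]) simp
  have [measurable]: "(\<lambda>\<omega>. H (int_field L n \<omega> (parent L x)) (\<omega> (Suc n, x))) \<in> borel_measurable (?M (?I \<union> ?J))"
    if "x \<in> Lam L (Suc n)" for x
  proof (rule H')
    show "(\<lambda>\<omega>. int_field L n \<omega> (parent L x)) \<in> borel_measurable (?M (?I \<union> ?J))"
      using that by (intro measurable_int_field) (auto simp: Lam_Suc)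
    have "(\<lambda>\<omega>. \<omega> (Suc n, x)) \<in> measurable (?M (?I \<union> ?J)) (gauss \<sigma>)"
      using that by (intro measurable_component_singleton) auto
    then show "(\<lambda>\<omega>. \<omega> (Suc n, x)) \<in> borel_measurable (?M (?I \<union> ?J))" by simp
  qed
  have "(\<integral>\<^sup>+\<omega>. F (restrict \<omega> ?I) * (\<Prod>x\<in>Lam L (Suc n). H (int_field L n \<omega> (parent L x)) (\<omega> (Suc n, x)))
      \<partial>?M (layers_upto L (Suc n))) =
    (\<integral>\<^sup>+\<omega>. \<integral>\<^sup>+\<omega>'. F (restrict (merge ?I ?J (\<omega>, \<omega>')) ?I) * (\<Prod>x\<in>Lam L (Suc n).
        H (int_field L n (merge ?I ?J (\<omega>, \<omega>')) (parent L x)) (merge ?I ?J (\<omega>, \<omega>') (Suc n, x))) \<partial>?M ?J \<partial>?M ?I)"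
    unfolding layers_upto_Suc
  proof (rule product_nn_integral_fold)
    show "?I \<inter> ?J = {}" by (auto simp: layers_upto_def)
  qed (auto intro!: borel_measurable_times_ennreal borel_measurable_prod_ennreal)
  also have "\<dots> = (\<integral>\<^sup>+\<omega>. F \<omega> * (\<Prod>y\<in>Lam L n. (\<integral>\<^sup>+z. H (int_field L n \<omega> y) z \<partial>gauss \<sigma>) ^ L\<^sup>2) \<partial>?M ?I)"
  proof (rule nn_integral_cong)
    fix \<omega> assume \<omega>: "\<omega> \<in> space (?M ?I)"
    \<comment> \<open>On a merged sample, everything that refers to old layers sees only
      \<open>\<omega>\<close>, and the new variables are those of \<open>\<omega>'\<close>.\<close>
    have "restrict (merge ?I ?J (\<omega>, \<omega>')) ?I = \<omega>" for \<omega>'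
      using \<omega> by (auto simp: fun_eq_iff space_PiM PiE_def extensional_def merge_def)
    moreover have "int_field L n (merge ?I ?J (\<omega>, \<omega>')) (parent L x) = int_field L n \<omega> (parent L x)"
      if "x \<in> Lam L (Suc n)" for \<omega>' x
      using that by (intro int_field_cong) (auto simp: Lam_Suc merge_def layers_upto_def)
    moreover have "merge ?I ?J (\<omega>, \<omega>') (Suc n, x) = \<omega>' (Suc n, x)" if "x \<in> Lam L (Suc n)" for \<omega>' x
      using that by (auto simp: merge_def layers_upto_def)
    moreover have "(\<Prod>x\<in>Lam L (Suc n). H (int_field L n \<omega> (parent L x)) (\<omega>' (Suc n, x))) =
        (\<Prod>i\<in>?J. H (int_field L n \<omega> (parent L (snd i))) (\<omega>' i))" for \<omega>'
      by (rule prod.reindex_bij_witness[of _ snd "Pair (Suc n)"]) auto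
    ultimately have "(\<integral>\<^sup>+\<omega>'. F (restrict (merge ?I ?J (\<omega>, \<omega>')) ?I) * (\<Prod>x\<in>Lam L (Suc n).
        H (int_field L n (merge ?I ?J (\<omega>, \<omega>')) (parent L x)) (merge ?I ?J (\<omega>, \<omega>') (Suc n, x))) \<partial>?M ?J) =
      (\<integral>\<^sup>+\<omega>'. F \<omega> * (\<Prod>i\<in>?J. H (int_field L n \<omega> (parent L (snd i))) (\<omega>' i)) \<partial>?M ?J)"
      by (simp cong: prod.cong)
    also have "\<dots> = F \<omega> * (\<integral>\<^sup>+\<omega>'. (\<Prod>i\<in>?J. H (int_field L n \<omega> (parent L (snd i))) (\<omega>' i)) \<partial>?M ?J)"
    proof (rule nn_integral_cmult)
      have "(\<lambda>\<omega>'. H (int_field L n \<omega> (parent L (snd i))) (\<omega>' i)) \<in> borel_measurable (?M ?J)" if "i \<in> ?J" for i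
      proof (rule H')
        have "(\<lambda>\<omega>'. \<omega>' i) \<in> measurable (?M ?J) (gauss \<sigma>)"
          using that by (rule measurable_component_singleton)
        then show "(\<lambda>\<omega>'. \<omega>' i) \<in> borel_measurable (?M ?J)" by simp
      qed simp
      then show "(\<lambda>\<omega>'. \<Prod>i\<in>?J. H (int_field L n \<omega> (parent L (snd i))) (\<omega>' i)) \<in> borel_measurable (?M ?J)"
        by (rule borel_measurable_prod_ennreal)
    qed
    also have "(\<integral>\<^sup>+\<omega>'. (\<Prod>i\<in>?J. H (int_field L n \<omega> (parent L (snd i))) (\<omega>' i)) \<partial>?M ?J) =
        (\<Prod>i\<in>?J. \<integral>\<^sup>+z. H (int_field L n \<omega> (parent L (snd i))) z \<partial>gauss \<sigma>)"
      by (rule product_nn_integral_prod) auto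
    also have "\<dots> = (\<Prod>x\<in>Lam L (Suc n). \<integral>\<^sup>+z. H (int_field L n \<omega> (parent L x)) z \<partial>gauss \<sigma>)"
      by (rule prod.reindex_bij_witness[of _ "Pair (Suc n)" snd]) auto
    also have "\<dots> = (\<Prod>y\<in>Lam L n. (\<integral>\<^sup>+z. H (int_field L n \<omega> y) z \<partial>gauss \<sigma>) ^ L\<^sup>2)"
      by (rule prod_Lam_Suc)
    finally show "(\<integral>\<^sup>+\<omega>'. F (restrict (merge ?I ?J (\<omega>, \<omega>')) ?I) * (\<Prod>x\<in>Lam L (Suc n).
        H (int_field L n (merge ?I ?J (\<omega>, \<omega>')) (parent L x)) (merge ?I ?J (\<omega>, \<omega>') (Suc n, x))) \<partial>?M ?J) =
      F \<omega> * (\<Prod>y\<in>Lam L n. (\<integral>\<^sup>+z. H (int_field L n \<omega> y) z \<partial>gauss \<sigma>) ^ L\<^sup>2)" .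
  qed
  finally show ?thesis .
qed

end

text \<open>For \<open>q = exp (- (\<kappa> * \<sigma>)\<^sup>2 / 2)\<close> the subtracted term is
  the Gaussian mean of the cosine given the older layers, so under the free field each increment is
  a martingale difference. \<open>\<tau>\<close> is the weight of a layer; the layers involved are
  \<open>Suc k0\<close> to \<open>n\<close>.\<close>

definition tilt_stat :: "nat \<Rightarrow> real \<Rightarrow> real \<Rightarrow> (nat \<Rightarrow> real) \<Rightarrow> nat \<Rightarrow> nat \<Rightarrow> (nat \<times> int \<times> int \<Rightarrow> real) \<Rightarrow> real" where
  "tilt_stat L \<kappa> q \<tau> k0 n \<omega> = (\<Sum>k=k0..<n. \<Sum>x\<in>Lam L (Suc k).
     \<tau> (Suc k) * (cos (\<kappa> * int_field L (Suc k) \<omega> x) - q * cos (\<kappa> * int_field L k \<omega> (parent L x))))"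

section \<open>Site weights under repeated averaging\<close>

definition bounded_weight :: "(real \<Rightarrow> real) \<Rightarrow> bool" where
  "bounded_weight W \<longleftrightarrow> W \<in> borel_measurable borel \<and> (\<forall>x. 0 \<le> W x) \<and> (\<exists>B. \<forall>x. W x \<le> B)"

lemma bounded_weightI:
  "W \<in> borel_measurable borel \<Longrightarrow> (\<And>x. 0 \<le> W x) \<Longrightarrow> (\<And>x. W x \<le> B) \<Longrightarrow> bounded_weight W"
  by (auto simp: bounded_weight_def)

context
  fixes L :: nat and \<sigma> :: real
  assumes L: "0 < L" and \<sigma>: "0 < \<sigma>"
begin

interpretation prob_space "gauss \<sigma>" using \<sigma> by (rule prob_space_normal_density)

abbreviation (input) "Pi_upto n \<equiv> PiM (layers_upto L n) (\<lambda>_. gauss \<sigma>)"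

lemma integrable_bounded_weight:
  assumes "bounded_weight W"
  shows "integrable (gauss \<sigma>) (\<lambda>z. W (\<phi> + z))"
proof -
  obtain B where "W \<in> borel_measurable borel" "\<And>x. 0 \<le> W x" "\<And>x. W x \<le> B"
    using assms by (auto simp: bounded_weight_def)
  then show ?thesis by (intro integrable_gauss_bounded[OF \<sigma>, of W B]) auto
qed

lemma bounded_weight_step:
  assumes "bounded_weight W"
  shows "bounded_weight (\<lambda>\<phi>. smooth \<sigma> W \<phi> ^ D)"
proof -
  obtain B where W [measurable]: "W \<in> borel_measurable borel" and B: "\<And>x. 0 \<le> W x" "\<And>x. W x \<le> B"
    using assms by (auto simp: bounded_weight_def)
  have nn: "0 \<le> smooth \<sigma> W \<phi>" for \<phi> unfolding smooth_def using B by (simp add: integral_nonneg_AE)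
  show ?thesis
  proof (rule bounded_weightI)
    show "(\<lambda>\<phi>. smooth \<sigma> W \<phi> ^ D) \<in> borel_measurable borel" unfolding smooth_def by measurable
    show "0 \<le> smooth \<sigma> W \<phi> ^ D" for \<phi> using nn by simp
    have "smooth \<sigma> W \<phi> \<le> B" for \<phi>
      unfolding smooth_def using B by (intro integral_le_const integrable_bounded_weight assms) auto
    then show "smooth \<sigma> W \<phi> ^ D \<le> B ^ D" for \<phi> by (intro power_mono nn)
  qed
qed

text \<open>\<open>rg\<close> appends steps at the end, whereas integrating out layers from the
  finest one down applies the first step to the initial weight.\<close>

lemma rg_Suc_shift: "rg \<sigma> D W (Suc j) = rg \<sigma> D (\<lambda>\<phi>. smooth \<sigma> W \<phi> ^ D) j"
  by (induction j) simp_all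

lemma bounded_weight_rg: "bounded_weight W \<Longrightarrow> bounded_weight (rg \<sigma> D W j)"
  by (induction j) (simp_all add: bounded_weight_step)

lemma nn_integral_bounded_weight:
  assumes "bounded_weight W"
  shows "(\<integral>\<^sup>+z. ennreal (W (\<phi> + z)) \<partial>gauss \<sigma>) = ennreal (smooth \<sigma> W \<phi>)"
  unfolding smooth_def using assms
  by (intro nn_integral_eq_integral integrable_bounded_weight) (auto simp: bounded_weight_def)

text \<open>Induction on the number of layers removed, finest first, with \<open>W\<close> arbitrary
  because one removal replaces it by its renormalised weight. \<open>F\<close> sees only layers up
  to \<open>n\<close> and is carried along unchanged.\<close>

lemma nn_integral_rg:
  fixes F :: "(nat \<times> int \<times> int \<Rightarrow> real) \<Rightarrow> ennreal"
  assumes F: "F \<in> borel_measurable (Pi_upto n)" and W: "bounded_weight W"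
  shows "(\<integral>\<^sup>+\<omega>. F (restrict \<omega> (layers_upto L n)) * (\<Prod>x\<in>Lam L (n + j). ennreal (W (int_field L (n + j) \<omega> x)))
      \<partial>Pi_upto (n + j)) =
    (\<integral>\<^sup>+\<omega>. F \<omega> * (\<Prod>x\<in>Lam L n. ennreal (rg \<sigma> (L\<^sup>2) W j (int_field L n \<omega> x))) \<partial>Pi_upto n)"
  using W
proof (induction j arbitrary: W)
  case 0
  have "restrict \<omega> (layers_upto L n) = \<omega>" if "\<omega> \<in> space (Pi_upto n)" for \<omega>
    by (rule PiE_restrict) (use that in \<open>simp add: space_PiM\<close>)
  then show ?case unfolding add_0_right by (simp cong: nn_integral_cong_simp)
next
  case (Suc j)
  let ?m = "n + j"
  have sub: "layers_upto L n \<subseteq> layers_upto L ?m" by (auto simp: layers_upto_def)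
  have [measurable]: "W \<in> borel_measurable borel" using Suc.prems by (simp add: bounded_weight_def)
  have F': "(\<lambda>\<omega>. F (restrict \<omega> (layers_upto L n))) \<in> borel_measurable (Pi_upto ?m)"
    by (rule measurable_compose[OF measurable_restrict_subset[OF sub] F])
  have "(\<integral>\<^sup>+\<omega>. F (restrict \<omega> (layers_upto L n)) * (\<Prod>x\<in>Lam L (Suc ?m). ennreal (W (int_field L (Suc ?m) \<omega> x)))
      \<partial>Pi_upto (Suc ?m)) =
    (\<integral>\<^sup>+\<omega>. F (restrict \<omega> (layers_upto L n)) *
      (\<Prod>x\<in>Lam L ?m. (\<integral>\<^sup>+z. ennreal (W (int_field L ?m \<omega> x + z)) \<partial>gauss \<sigma>) ^ L\<^sup>2) \<partial>Pi_upto ?m)"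
    using nn_integral_layer[OF L \<sigma> F', of "\<lambda>\<phi> z. ennreal (W (\<phi> + z))"] by (simp add: Int_absorb1[OF sub])
  also have "\<dots> = (\<integral>\<^sup>+\<omega>. F (restrict \<omega> (layers_upto L n)) *
      (\<Prod>x\<in>Lam L ?m. ennreal (smooth \<sigma> W (int_field L ?m \<omega> x) ^ L\<^sup>2)) \<partial>Pi_upto ?m)"
    using Suc.prems
    by (simp add: nn_integral_bounded_weight ennreal_power smooth_def bounded_weight_def integral_nonneg_AE)
  also have "\<dots> = (\<integral>\<^sup>+\<omega>. F \<omega> * (\<Prod>x\<in>Lam L n. ennreal (rg \<sigma> (L\<^sup>2) W (Suc j) (int_field L n \<omega> x))) \<partial>Pi_upto n)"
    unfolding rg_Suc_shift by (intro Suc.IH bounded_weight_step Suc.prems)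
  finally show ?case unfolding add_Suc_right .
qed

section \<open>Exponential moments of the statistic\<close>

lemma tilt_stat_restrict: "n \<le> m \<Longrightarrow> tilt_stat L \<kappa> q \<tau> k0 n (restrict \<omega> (layers_upto L m)) = tilt_stat L \<kappa> q \<tau> k0 n \<omega>"
  unfolding tilt_stat_def
  by (intro sum.cong refl) (simp add: int_field_restrict[OF L] Lam_Suc[OF L] del: int_field.simps)

lemma measurable_tilt_stat:
  assumes "layers_upto L n \<subseteq> I"
  shows "tilt_stat L \<kappa> q \<tau> k0 n \<in> borel_measurable (PiM I (\<lambda>_. gauss \<sigma>))"
proof -
  have m: "(\<lambda>\<omega>. int_field L k \<omega> x) \<in> borel_measurable (PiM I (\<lambda>_. gauss \<sigma>))" if "k \<le> n" "x \<in> Lam L k" for k x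
    using that assms by (intro measurable_int_field[OF L]) (auto simp: layers_upto_def)
  show ?thesis unfolding tilt_stat_def
  proof (intro borel_measurable_sum)
    fix k x assume k: "k \<in> {k0..<n}" "x \<in> Lam L (Suc k)"
    have [measurable]: "(\<lambda>\<omega>. int_field L (Suc k) \<omega> x) \<in> borel_measurable (PiM I (\<lambda>_. gauss \<sigma>))"
      "(\<lambda>\<omega>. int_field L k \<omega> (parent L x)) \<in> borel_measurable (PiM I (\<lambda>_. gauss \<sigma>))"
      using k by (auto intro!: m simp: Lam_Suc[OF L] simp del: int_field.simps)
    show "(\<lambda>\<omega>. \<tau> (Suc k) * (cos (\<kappa> * int_field L (Suc k) \<omega> x) - q * cos (\<kappa> * int_field L k \<omega> (parent L x))))
      \<in> borel_measurable (PiM I (\<lambda>_. gauss \<sigma>))"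
      by measurable
  qed
qed

text \<open>The tilt of a layer is a product over its sites of functions of the parent field and the
  new variable, so it joins \<open>W\<close> in the layer integral. Each site then costs the factor
  \<open>c\<close> relative to the untilted average.\<close>

lemma nn_integral_tilted_layer:
  fixes F :: "(nat \<times> int \<times> int \<Rightarrow> real) \<Rightarrow> ennreal"
  assumes F: "F \<in> borel_measurable (Pi_upto n)" and W: "bounded_weight W" and c: "0 \<le> c"
    and bound: "\<And>\<phi>. (\<integral>z. W (\<phi> + z) * exp (t * (cos (\<kappa> * (\<phi> + z)) - q * cos (\<kappa> * \<phi>))) \<partial>gauss \<sigma>) \<le> c * smooth \<sigma> W \<phi>"
  shows "(\<integral>\<^sup>+\<omega>. F (restrict \<omega> (layers_upto L n)) *
      (ennreal (exp (\<Sum>x\<in>Lam L (Suc n). t * (cos (\<kappa> * int_field L (Suc n) \<omega> x) - q * cos (\<kappa> * int_field L n \<omega> (parent L x))))) *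
      (\<Prod>x\<in>Lam L (Suc n). ennreal (W (int_field L (Suc n) \<omega> x)))) \<partial>Pi_upto (Suc n)) \<le>
    ennreal (c ^ L ^ (2 * Suc n)) *
      (\<integral>\<^sup>+\<omega>. F \<omega> * (\<Prod>y\<in>Lam L n. ennreal (smooth \<sigma> W (int_field L n \<omega> y) ^ L\<^sup>2)) \<partial>Pi_upto n)"
proof -
  define h where "h \<phi> z = exp (t * (cos (\<kappa> * (\<phi> + z)) - q * cos (\<kappa> * \<phi>)))" for \<phi> z
  have [measurable]: "W \<in> borel_measurable borel" and nn: "\<And>x. 0 \<le> W x"
    using W by (auto simp: bounded_weight_def)
  have snn: "0 \<le> smooth \<sigma> W \<phi>" for \<phi> unfolding smooth_def using nn by (simp add: integral_nonneg_AE)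
  have hb: "h \<phi> z \<le> exp (\<bar>t\<bar> * (1 + \<bar>q\<bar>))" for \<phi> z
  proof -
    have "\<bar>q * cos (\<kappa> * \<phi>)\<bar> \<le> \<bar>q\<bar>" by (simp add: abs_mult mult_left_le)
    then have "\<bar>cos (\<kappa> * (\<phi> + z)) - q * cos (\<kappa> * \<phi>)\<bar> \<le> 1 + \<bar>q\<bar>"
      using abs_cos_le_one[of "\<kappa> * (\<phi> + z)"] by linarith
    then have "\<bar>t * (cos (\<kappa> * (\<phi> + z)) - q * cos (\<kappa> * \<phi>))\<bar> \<le> \<bar>t\<bar> * (1 + \<bar>q\<bar>)"
      unfolding abs_mult by (rule mult_left_mono) simp
    then show ?thesis unfolding h_def by (simp add: abs_le_iff)
  qed
  have int: "integrable (gauss \<sigma>) (\<lambda>z. W (\<phi> + z) * h \<phi> z)" for \<phi>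
  proof (rule Bochner_Integration.integrable_bound)
    show "integrable (gauss \<sigma>) (\<lambda>z. W (\<phi> + z) * exp (\<bar>t\<bar> * (1 + \<bar>q\<bar>)))"
      by (intro integrable_mult_left integrable_bounded_weight W)
    show "AE z in gauss \<sigma>. norm (W (\<phi> + z) * h \<phi> z) \<le> norm (W (\<phi> + z) * exp (\<bar>t\<bar> * (1 + \<bar>q\<bar>)))"
      using nn hb[of \<phi>] by (intro AE_I2) (simp add: abs_mult mult_left_mono h_def)
  qed (simp add: h_def)
  have bound': "(\<integral>\<^sup>+z. ennreal (W (\<phi> + z) * h \<phi> z) \<partial>gauss \<sigma>) \<le> ennreal (c * smooth \<sigma> W \<phi>)" for \<phi>
    using bound[of \<phi>] nn
    by (subst nn_integral_eq_integral[OF int]) (auto simp: h_def intro!: AE_I2 ennreal_leI)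
  have "(\<integral>\<^sup>+\<omega>. F (restrict \<omega> (layers_upto L n)) *
      (ennreal (exp (\<Sum>x\<in>Lam L (Suc n). t * (cos (\<kappa> * int_field L (Suc n) \<omega> x) - q * cos (\<kappa> * int_field L n \<omega> (parent L x))))) *
      (\<Prod>x\<in>Lam L (Suc n). ennreal (W (int_field L (Suc n) \<omega> x)))) \<partial>Pi_upto (Suc n)) =
    (\<integral>\<^sup>+\<omega>. F (restrict \<omega> (layers_upto L n)) *
      (\<Prod>x\<in>Lam L (Suc n). ennreal (W (int_field L n \<omega> (parent L x) + \<omega> (Suc n, x)) *
         h (int_field L n \<omega> (parent L x)) (\<omega> (Suc n, x)))) \<partial>Pi_upto (Suc n))"
    using nn by (simp add: h_def exp_sum prod_ennreal prod_nonneg ennreal_mult' prod.distrib mult.commute)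
  also have "\<dots> = (\<integral>\<^sup>+\<omega>. F \<omega> *
      (\<Prod>y\<in>Lam L n. (\<integral>\<^sup>+z. ennreal (W (int_field L n \<omega> y + z) * h (int_field L n \<omega> y) z) \<partial>gauss \<sigma>) ^ L\<^sup>2) \<partial>Pi_upto n)"
    by (rule nn_integral_layer[OF L \<sigma> F]) (simp add: h_def)
  also have "\<dots> \<le> (\<integral>\<^sup>+\<omega>. F \<omega> * (\<Prod>y\<in>Lam L n. ennreal (c * smooth \<sigma> W (int_field L n \<omega> y)) ^ L\<^sup>2) \<partial>Pi_upto n)"
    by (intro nn_integral_mono mult_left_mono prod_mono_ennreal power_mono bound') auto
  also have "\<dots> = (\<integral>\<^sup>+\<omega>. ennreal (c ^ L ^ (2 * Suc n)) *
      (F \<omega> * (\<Prod>y\<in>Lam L n. ennreal (smooth \<sigma> W (int_field L n \<omega> y) ^ L\<^sup>2))) \<partial>Pi_upto n)"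
  proof (rule nn_integral_cong)
    fix \<omega>
    have "(\<Prod>y\<in>Lam L n. ennreal (c * smooth \<sigma> W (int_field L n \<omega> y)) ^ L\<^sup>2) =
        ennreal (\<Prod>y\<in>Lam L n. c ^ L\<^sup>2 * smooth \<sigma> W (int_field L n \<omega> y) ^ L\<^sup>2)"
      using c snn by (simp add: prod_ennreal ennreal_power power_mult_distrib)
    \<comment> \<open>There are \<open>L ^ (2 * n)\<close> parents with \<open>L\<^sup>2\<close>
      children each, hence \<open>L ^ (2 * Suc n)\<close> factors \<open>c\<close>.\<close>
    also have "(\<Prod>y\<in>Lam L n. c ^ L\<^sup>2 * smooth \<sigma> W (int_field L n \<omega> y) ^ L\<^sup>2) =
        c ^ L ^ (2 * Suc n) * (\<Prod>y\<in>Lam L n. smooth \<sigma> W (int_field L n \<omega> y) ^ L\<^sup>2)"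
      by (simp add: prod.distrib card_Lam power2_eq_square mult.assoc flip: power_mult)
    also have "ennreal \<dots> = ennreal (c ^ L ^ (2 * Suc n)) * (\<Prod>y\<in>Lam L n. ennreal (smooth \<sigma> W (int_field L n \<omega> y) ^ L\<^sup>2))"
      using c snn by (simp add: ennreal_mult prod_ennreal prod_nonneg)
    finally show "F \<omega> * (\<Prod>y\<in>Lam L n. ennreal (c * smooth \<sigma> W (int_field L n \<omega> y)) ^ L\<^sup>2) =
        ennreal (c ^ L ^ (2 * Suc n)) * (F \<omega> * (\<Prod>y\<in>Lam L n. ennreal (smooth \<sigma> W (int_field L n \<omega> y) ^ L\<^sup>2)))"
      by (simp add: mult.left_commute)
  qed
  also have "\<dots> = ennreal (c ^ L ^ (2 * Suc n)) *
      (\<integral>\<^sup>+\<omega>. F \<omega> * (\<Prod>y\<in>Lam L n. ennreal (smooth \<sigma> W (int_field L n \<omega> y) ^ L\<^sup>2)) \<partial>Pi_upto n)"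
  proof (rule nn_integral_cmult)
    have "(\<lambda>\<phi>. smooth \<sigma> W \<phi> ^ L\<^sup>2) \<in> borel_measurable borel"
      using bounded_weight_step[OF W] by (simp add: bounded_weight_def)
    note measurable_compose[OF measurable_int_field[OF L] this]
    then show "(\<lambda>\<omega>. F \<omega> * (\<Prod>y\<in>Lam L n. ennreal (smooth \<sigma> W (int_field L n \<omega> y) ^ L\<^sup>2))) \<in> borel_measurable (Pi_upto n)"
      by (intro borel_measurable_times_ennreal F borel_measurable_prod_ennreal measurable_compose[OF _ measurable_ennreal]) auto
  qed
  finally show ?thesis .
qed

text \<open>Layers are removed from \<open>n\<close> down to \<open>k0\<close>. Each costs at most
  \<open>\<rho>\<close>, and by the recursion for \<open>W\<close> what remains is the same integral
  one layer lower.\<close>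

lemma nn_integral_exp_tilt_stat:
  assumes "k0 \<le> n" "0 \<le> \<rho>"
    and W: "\<And>k. k0 \<le> k \<Longrightarrow> k < n \<Longrightarrow> bounded_weight (W (Suc k))"
      "\<And>k. k0 \<le> k \<Longrightarrow> k < n \<Longrightarrow> W k = (\<lambda>\<phi>. smooth \<sigma> (W (Suc k)) \<phi> ^ L\<^sup>2)"
    and c: "\<And>k. k0 \<le> k \<Longrightarrow> k < n \<Longrightarrow> 0 \<le> c (Suc k)" "\<And>k. k0 \<le> k \<Longrightarrow> k < n \<Longrightarrow> c (Suc k) ^ L ^ (2 * Suc k) \<le> \<rho>"
      "\<And>k \<phi>. k0 \<le> k \<Longrightarrow> k < n \<Longrightarrow> (\<integral>z. W (Suc k) (\<phi> + z) *
         exp (\<tau> (Suc k) * (cos (\<kappa> * (\<phi> + z)) - q * cos (\<kappa> * \<phi>))) \<partial>gauss \<sigma>) \<le> c (Suc k) * smooth \<sigma> (W (Suc k)) \<phi>"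
  shows "(\<integral>\<^sup>+\<omega>. ennreal (exp (tilt_stat L \<kappa> q \<tau> k0 n \<omega>)) * (\<Prod>x\<in>Lam L n. ennreal (W n (int_field L n \<omega> x))) \<partial>Pi_upto n)
    \<le> ennreal (\<rho> ^ (n - k0)) * (\<integral>\<^sup>+\<omega>. (\<Prod>x\<in>Lam L k0. ennreal (W k0 (int_field L k0 \<omega> x))) \<partial>Pi_upto k0)"
  using assms
proof (induction n rule: dec_induct)
  case base
  show ?case by (simp add: tilt_stat_def)
next
  case (step n)
  let ?E = "\<lambda>\<omega>. ennreal (exp (tilt_stat L \<kappa> q \<tau> k0 n \<omega>))"
  let ?W = "\<lambda>n \<omega>. \<Prod>x\<in>Lam L n. ennreal (W n (int_field L n \<omega> x))"
  let ?t = "\<lambda>\<omega>. \<Sum>x\<in>Lam L (Suc n). \<tau> (Suc n) * (cos (\<kappa> * int_field L (Suc n) \<omega> x) - q * cos (\<kappa> * int_field L n \<omega> (parent L x)))"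
  have split: "tilt_stat L \<kappa> q \<tau> k0 (Suc n) \<omega> = tilt_stat L \<kappa> q \<tau> k0 n (restrict \<omega> (layers_upto L n)) + ?t \<omega>" for \<omega>
    unfolding tilt_stat_restrict[OF order_refl] using step.hyps by (simp add: tilt_stat_def)
  have E: "?E \<in> borel_measurable (Pi_upto n)"
    by (intro measurable_compose[OF measurable_tilt_stat] measurable_compose[OF borel_measurable_exp measurable_ennreal]) simp
  have "(\<integral>\<^sup>+\<omega>. ennreal (exp (tilt_stat L \<kappa> q \<tau> k0 (Suc n) \<omega>)) * ?W (Suc n) \<omega> \<partial>Pi_upto (Suc n)) =
    (\<integral>\<^sup>+\<omega>. ?E (restrict \<omega> (layers_upto L n)) * (ennreal (exp (?t \<omega>)) * ?W (Suc n) \<omega>) \<partial>Pi_upto (Suc n))"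
    unfolding split exp_add by (simp only: ennreal_mult' exp_ge_zero mult.assoc)
  also have "\<dots> \<le> ennreal (c (Suc n) ^ L ^ (2 * Suc n)) *
      (\<integral>\<^sup>+\<omega>. ?E \<omega> * (\<Prod>y\<in>Lam L n. ennreal (smooth \<sigma> (W (Suc n)) (int_field L n \<omega> y) ^ L\<^sup>2)) \<partial>Pi_upto n)"
    using step.hyps by (intro nn_integral_tilted_layer E step.prems) auto
  also have "\<dots> = ennreal (c (Suc n) ^ L ^ (2 * Suc n)) * (\<integral>\<^sup>+\<omega>. ?E \<omega> * ?W n \<omega> \<partial>Pi_upto n)"
    unfolding step.prems(3)[OF step.hyps(1) lessI] by simp
  also have "\<dots> \<le> ennreal \<rho> * (ennreal (\<rho> ^ (n - k0)) * (\<integral>\<^sup>+\<omega>. ?W k0 \<omega> \<partial>Pi_upto k0))"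
    using step.hyps by (intro mult_mono ennreal_leI step.IH step.prems) auto
  also have "\<dots> = ennreal (\<rho> ^ (Suc n - k0)) * (\<integral>\<^sup>+\<omega>. ?W k0 \<omega> \<partial>Pi_upto k0)"
    using step.hyps step.prems(1) by (simp add: Suc_diff_le ennreal_mult' mult.assoc)
  finally show ?case .
qed

end

text \<open>Together with continuity, this makes the exponential of the statistic an admissible test
  function for weak convergence.\<close>

lemma tilt_stat_abs_le:
  "\<exists>B. \<forall>\<omega>. \<bar>tilt_stat L \<kappa> q \<tau> k0 n \<omega>\<bar> \<le> B"
proof -
  have "\<bar>cos (\<kappa> * u) - q * cos (\<kappa> * v)\<bar> \<le> 1 + \<bar>q\<bar>" for u v
  proof -
    have "\<bar>q * cos (\<kappa> * v)\<bar> \<le> \<bar>q\<bar>" by (simp add: abs_mult mult_left_le)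
    then show ?thesis using abs_cos_le_one[of "\<kappa> * u"] by linarith
  qed
  then have "\<bar>tilt_stat L \<kappa> q \<tau> k0 n \<omega>\<bar> \<le> (\<Sum>k=k0..<n. \<Sum>x\<in>Lam L (Suc k). \<bar>\<tau> (Suc k)\<bar> * (1 + \<bar>q\<bar>))" for \<omega>
    unfolding tilt_stat_def by (intro order.trans[OF sum_abs] sum_mono) (simp add: abs_mult mult_left_mono del: int_field.simps)
  then show ?thesis by blast
qed

lemma continuous_int_field: "continuous_on UNIV (\<lambda>\<omega>. int_field L n \<omega> x)"
proof (induction n arbitrary: x)
  case (Suc n)
  show ?case unfolding int_field.simps by (intro continuous_on_add Suc continuous_on_product_coordinates)
qed simp

lemma continuous_tilt_stat: "continuous_on UNIV (\<lambda>\<omega>. tilt_stat L \<kappa> q \<tau> k0 n \<omega>)"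
proof -
  have c: "continuous_on UNIV (\<lambda>\<omega>. cos (\<kappa> * int_field L k \<omega> x))" for k x
    by (rule continuous_on_cos[OF continuous_on_mult_left[OF continuous_int_field]])
  show ?thesis
    unfolding tilt_stat_def
    by (rule continuous_on_sum)+ (rule continuous_on_mult_left[OF continuous_on_diff[OF c continuous_on_mult_left[OF c]]])
qed

lemma tilt_stat_uminus: "tilt_stat L \<kappa> q (\<lambda>k. - \<tau> k) k0 n \<omega> = - tilt_stat L \<kappa> q \<tau> k0 n \<omega>"
  by (simp add: tilt_stat_def sum_negf)

section \<open>The given measures in terms of finitely many layers\<close>

lemma SG_weight_eq:
  assumes "0 < L"
  shows "SG_weight L \<beta> a N \<omega> =
    (\<Prod>x\<in>Lam L N. exp (- a * real L powr (- real N * (2 - \<beta>)) * cos (sqrt \<beta> * int_field L N \<omega> x)))"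
  unfolding SG_weight_def sum_barLam[OF assms, where f = "\<lambda>u. a * real L powr (- real N * (2 - \<beta>)) * cos (sqrt \<beta> * u)"]
  by (simp only: sum_negf[symmetric] exp_sum[OF finite_Lam] mult_minus_left)

lemma nn_integral_hGFF:
  assumes L: "2 \<le> L" and F: "F \<in> borel_measurable (PiM (layers_upto L n) (\<lambda>_. gauss (sqrt (2 * ln (real L)))))"
  shows "(\<integral>\<^sup>+\<omega>. F (restrict \<omega> (layers_upto L n)) \<partial>hGFF L) =
    (\<integral>\<^sup>+\<omega>. F \<omega> \<partial>PiM (layers_upto L n) (\<lambda>_. gauss (sqrt (2 * ln (real L)))))"
proof -
  let ?g = "gauss (sqrt (2 * ln (real L)))"
  interpret prob_space ?g using L by (intro prob_space_normal_density) simp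
  interpret product_prob_space "\<lambda>_. ?g" "layers L" by standard
  have sub: "layers_upto L n \<subseteq> layers L" by (auto simp: layers_upto_def layers_def)
  have "(\<integral>\<^sup>+\<omega>. F \<omega> \<partial>PiM (layers_upto L n) (\<lambda>_. ?g)) =
      (\<integral>\<^sup>+\<omega>. F \<omega> \<partial>distr (PiM (layers L) (\<lambda>_. ?g)) (PiM (layers_upto L n) (\<lambda>_. ?g))
        (\<lambda>\<omega>. restrict \<omega> (layers_upto L n)))"
    by (simp only: distr_PiM_restrict_finite[OF finite_layers_upto sub])
  also have "\<dots> = (\<integral>\<^sup>+\<omega>. F (restrict \<omega> (layers_upto L n)) \<partial>PiM (layers L) (\<lambda>_. ?g))"
    by (rule nn_integral_distr[OF measurable_restrict_subset[OF sub]]) (simp add: F)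
  finally show ?thesis by (simp only: hGFF_def)
qed

section \<open>Separation of the two measures\<close>

context
  fixes L :: nat and \<beta> a :: real
  assumes L: "2 \<le> L" and \<beta>: "1 \<le> \<beta>" "\<beta> < 2" and a: "a \<noteq> 0"
begin

private definition "sd = sqrt (2 * ln (real L))"
private definition "q = real L powr - \<beta>"
private definition "coup N = - a * real L powr (- real N * (2 - \<beta>))"
private definition "bare N = (\<lambda>\<phi>. exp (coup N * cos (sqrt \<beta> * \<phi>)))"

private lemma L0: "0 < L" and sd: "0 < sd"
  using L by (auto simp: sd_def)

private lemma q_eq: "q = exp (- (sqrt \<beta> * sd)\<^sup>2 / 2)"
  using L \<beta> by (simp add: q_def sd_def powr_def power_mult_distrib)

private lemma q_less_1: "0 < q" "q < 1"
  using L \<beta> by (auto simp: q_def powr_less_one)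

private lemma b_eq: "real (L\<^sup>2) * q = real L powr (2 - \<beta>)"
  using L by (simp add: q_def powr_diff powr_minus divide_inverse powr_numeral)

text \<open>The linear flow carries the bare coupling at cutoff \<open>n + j\<close> exactly to the
  coupling at level \<open>n\<close>, so the renormalised first-order coefficient at a fixed level
  does not depend on the cutoff.\<close>

private lemma coup_step: "(real (L\<^sup>2) * q) ^ j * coup (n + j) = coup n"
proof -
  have "(real L powr (2 - \<beta>)) ^ j = real L powr ((2 - \<beta>) * real j)"
    using L by (subst powr_realpow[symmetric]) (simp_all add: powr_powr)
  moreover have "real L powr ((2 - \<beta>) * real j) * real L powr (- real (n + j) * (2 - \<beta>)) =
      real L powr (- real n * (2 - \<beta>))"
    unfolding powr_add[symmetric] by (simp add: algebra_simps)
  ultimately show ?thesis unfolding b_eq coup_def by (simp only: mult.left_commute)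
qed

private lemma bounded_bare: "bounded_weight (bare N)"
proof (rule bounded_weightI)
  show "bare N x \<le> exp \<bar>coup N\<bar>" for x
  proof -
    have "coup N * cos (sqrt \<beta> * x) \<le> \<bar>coup N * cos (sqrt \<beta> * x)\<bar>" by simp
    also have "\<dots> \<le> \<bar>coup N\<bar>" by (simp add: abs_mult mult_left_le)
    finally show ?thesis by (simp add: bare_def)
  qed
qed (auto simp: bare_def)

private lemma SG_weight_bare: "SG_weight L \<beta> a N \<omega> = (\<Prod>x\<in>Lam L N. bare N (int_field L N \<omega> x))"
  by (simp add: SG_weight_eq[OF L0] bare_def coup_def)

private lemma SG_weight_bounds: "\<exists>B>0. \<forall>\<omega>. inverse B \<le> SG_weight L \<beta> a N \<omega> \<and> SG_weight L \<beta> a N \<omega> \<le> B"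
proof -
  have "\<bar>\<Sum>x\<in>Lam L N. coup N * cos (sqrt \<beta> * int_field L N \<omega> x)\<bar> \<le> (\<Sum>x\<in>Lam L N. \<bar>coup N\<bar>)" for \<omega>
    by (intro order.trans[OF sum_abs] sum_mono) (simp add: abs_mult mult_left_le)
  then have "\<bar>\<Sum>x\<in>Lam L N. coup N * cos (sqrt \<beta> * int_field L N \<omega> x)\<bar> \<le> card (Lam L N) * \<bar>coup N\<bar>" for \<omega>
    by simp
  then have *: "- (card (Lam L N) * \<bar>coup N\<bar>) \<le> (\<Sum>x\<in>Lam L N. coup N * cos (sqrt \<beta> * int_field L N \<omega> x))"
    "(\<Sum>x\<in>Lam L N. coup N * cos (sqrt \<beta> * int_field L N \<omega> x)) \<le> card (Lam L N) * \<bar>coup N\<bar>" for \<omega>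
    by (simp_all only: abs_le_iff minus_le_iff)
  have "SG_weight L \<beta> a N \<omega> = exp (\<Sum>x\<in>Lam L N. coup N * cos (sqrt \<beta> * int_field L N \<omega> x))" for \<omega>
    by (simp add: SG_weight_bare bare_def exp_sum)
  with * show ?thesis
    by (intro exI[of _ "exp (card (Lam L N) * \<bar>coup N\<bar>)"]) (simp flip: exp_minus)
qed

private lemma layers_upto_subset: "layers_upto L n \<subseteq> layers L"
  by (auto simp: layers_upto_def layers_def)

private lemma hGFF_eq: "hGFF L = PiM (layers L) (\<lambda>_. gauss sd)"
  by (simp add: hGFF_def sd_def)

private lemma prob_space_hGFF: "prob_space (hGFF L)"
  unfolding hGFF_eq using sd by (intro prob_space_PiM prob_space_normal_density)

private lemma measurable_SG_weight: "SG_weight L \<beta> a N \<in> borel_measurable (hGFF L)"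
  unfolding SG_weight_bare[abs_def] hGFF_eq
  using bounded_bare[of N] layers_upto_subset
  by (intro borel_measurable_prod measurable_compose[OF measurable_int_field[OF L0]])
     (auto simp: bounded_weight_def)

text \<open>A cutoff expectation is a quotient of two integrals against the same weight. The
  numerator is reduced to the layers up to \<open>n\<close> and the partition function to those up
  to \<open>k\<close>; comparing them directly avoids computing the normalisations produced by the
  flow. \<open>B\<close> serves integrability.\<close>

private lemma cutoff_integral_le:
  assumes F: "F \<in> borel_measurable (PiM (layers_upto L n) (\<lambda>_. gauss sd))"
    and F0: "\<And>\<omega>. 0 \<le> F \<omega>" and FB: "\<And>\<omega>. F \<omega> \<le> B" and "n \<le> N" "k \<le> N" and r: "0 \<le> r"
    and le: "(\<integral>\<^sup>+\<omega>. ennreal (F \<omega>) * (\<Prod>x\<in>Lam L n. ennreal (rg sd (L\<^sup>2) (bare N) (N - n) (int_field L n \<omega> x)))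
        \<partial>PiM (layers_upto L n) (\<lambda>_. gauss sd)) \<le>
      ennreal r * (\<integral>\<^sup>+\<omega>. (\<Prod>x\<in>Lam L k. ennreal (rg sd (L\<^sup>2) (bare N) (N - k) (int_field L k \<omega> x)))
        \<partial>PiM (layers_upto L k) (\<lambda>_. gauss sd))"
  shows "(\<integral>\<omega>. F (restrict \<omega> (layers_upto L n)) \<partial>hSG_cutoff L \<beta> a N) \<le> r"
proof -
  interpret prob_space "hGFF L" by (rule prob_space_hGFF)
  let ?W = "SG_weight L \<beta> a N"
  obtain C where C: "C > 0" "\<And>\<omega>. inverse C \<le> ?W \<omega>" "\<And>\<omega>. ?W \<omega> \<le> C" using SG_weight_bounds by blast
  have W0: "0 < ?W \<omega>" for \<omega> using C(1) C(2)[of \<omega>] by (meson less_le_trans positive_imp_inverse_positive)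
  note [measurable] = measurable_SG_weight
  have Fm [measurable]: "(\<lambda>\<omega>. F (restrict \<omega> (layers_upto L n))) \<in> borel_measurable (hGFF L)"
    unfolding hGFF_eq by (rule measurable_compose[OF measurable_restrict_subset[OF layers_upto_subset] F])
  have Wint: "integrable (hGFF L) ?W"
    using W0 C by (intro integrable_const_bound[of _ C]) (auto simp: less_imp_le)
  have WFint: "integrable (hGFF L) (\<lambda>\<omega>. ?W \<omega> * F (restrict \<omega> (layers_upto L n)))"
  proof (rule integrable_const_bound[of _ "C * B"])
    show "AE \<omega> in hGFF L. norm (?W \<omega> * F (restrict \<omega> (layers_upto L n))) \<le> C * B"
      using F0 FB C W0 by (intro AE_I2) (auto simp: abs_mult less_imp_le intro!: mult_mono)
  qed simp
  define Z where "Z = (\<integral>\<omega>. ?W \<omega> \<partial>hGFF L)"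
  have "inverse C \<le> Z" unfolding Z_def using C by (intro integral_ge_const Wint) auto
  then have Z: "0 < Z" using C(1) by (meson less_le_trans positive_imp_inverse_positive)
  have peel: "(\<integral>\<^sup>+\<omega>. ennreal (?W \<omega>) * G (restrict \<omega> (layers_upto L m)) \<partial>hGFF L) =
      (\<integral>\<^sup>+\<omega>. G \<omega> * (\<Prod>x\<in>Lam L m. ennreal (rg sd (L\<^sup>2) (bare N) (N - m) (int_field L m \<omega> x)))
        \<partial>PiM (layers_upto L m) (\<lambda>_. gauss sd))"
    if "m \<le> N" and G: "G \<in> borel_measurable (PiM (layers_upto L m) (\<lambda>_. gauss sd))" for m and G :: "_ \<Rightarrow> ennreal"
  proof -
    let ?H = "\<lambda>\<omega>. G (restrict \<omega> (layers_upto L m)) * (\<Prod>x\<in>Lam L N. ennreal (bare N (int_field L N \<omega> x)))"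
    have sub: "layers_upto L m \<subseteq> layers_upto L N" using that by (auto simp: layers_upto_def)
    have H: "?H \<in> borel_measurable (PiM (layers_upto L N) (\<lambda>_. gauss sd))"
      using bounded_bare[of N]
      by (intro borel_measurable_times_ennreal measurable_compose[OF measurable_restrict_subset[OF sub] G]
            borel_measurable_prod_ennreal measurable_compose[OF _ measurable_ennreal]
            measurable_compose[OF measurable_int_field[OF L0]])
         (auto simp: bounded_weight_def)
    have "(\<integral>\<^sup>+\<omega>. ennreal (?W \<omega>) * G (restrict \<omega> (layers_upto L m)) \<partial>hGFF L) =
        (\<integral>\<^sup>+\<omega>. ?H (restrict \<omega> (layers_upto L N)) \<partial>hGFF L)"
      using sub by (simp add: SG_weight_bare int_field_restrict[OF L0] prod_ennreal bare_def Int_absorb1 mult.commute)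
    also have "\<dots> = (\<integral>\<^sup>+\<omega>. ?H \<omega> \<partial>PiM (layers_upto L N) (\<lambda>_. gauss sd))"
      using nn_integral_hGFF[OF L, of ?H N] H by (simp add: sd_def)
    also have "\<dots> = (\<integral>\<^sup>+\<omega>. G \<omega> * (\<Prod>x\<in>Lam L m. ennreal (rg sd (L\<^sup>2) (bare N) (N - m) (int_field L m \<omega> x)))
        \<partial>PiM (layers_upto L m) (\<lambda>_. gauss sd))"
      using nn_integral_rg[OF L0 sd G bounded_bare[of N], of "N - m"] that by simp
    finally show ?thesis .
  qed
  have "ennreal (\<integral>\<omega>. ?W \<omega> * F (restrict \<omega> (layers_upto L n)) \<partial>hGFF L) =
      (\<integral>\<^sup>+\<omega>. ennreal (?W \<omega>) * ennreal (F (restrict \<omega> (layers_upto L n))) \<partial>hGFF L)"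
    using F0 W0
    by (subst nn_integral_eq_integral[OF WFint, symmetric]) (auto simp: less_imp_le ennreal_mult)
  also have "\<dots> \<le> ennreal r * (\<integral>\<^sup>+\<omega>. ennreal (?W \<omega>) * 1 \<partial>hGFF L)"
    using le by (subst (1 2) peel) (use F \<open>n \<le> N\<close> \<open>k \<le> N\<close> in auto)
  also have "\<dots> = ennreal (r * Z)"
    using W0 r Z by (subst mult_1_right, subst nn_integral_eq_integral[OF Wint])
      (auto simp: less_imp_le ennreal_mult Z_def)
  finally have *: "(\<integral>\<omega>. ?W \<omega> * F (restrict \<omega> (layers_upto L n)) \<partial>hGFF L) \<le> r * Z"
    using r Z by (subst (asm) ennreal_le_iff) auto
  have "(\<integral>\<omega>. F (restrict \<omega> (layers_upto L n)) \<partial>hSG_cutoff L \<beta> a N) =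
      (\<integral>\<omega>. (?W \<omega> / Z) * F (restrict \<omega> (layers_upto L n)) \<partial>hGFF L)"
    unfolding hSG_cutoff_def Z_def[symmetric]
    using W0 Z by (subst integral_density) (auto simp: less_imp_le)
  also have "\<dots> = (\<integral>\<omega>. ?W \<omega> * F (restrict \<omega> (layers_upto L n)) \<partial>hGFF L) / Z"
    by (simp add: field_simps)
  also have "\<dots> \<le> r" using * Z by (simp add: field_simps)
  finally show ?thesis .
qed

text \<open>Here \<open>\<beta> \<ge> 1\<close> enters: the right-hand side is
  \<open>\<bar>a\<bar> * L powr (k * (\<beta> - 1))\<close>.\<close>

private lemma coup_scaling: "\<bar>a\<bar> \<le> real L ^ k * \<bar>coup k\<bar>"
proof -
  have "real L ^ k * real L powr (- real k * (2 - \<beta>)) = real L powr (real k * (\<beta> - 1))"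
    using L by (simp add: powr_realpow[symmetric] powr_add[symmetric] algebra_simps)
  moreover have "1 \<le> real L powr (real k * (\<beta> - 1))" using L \<beta> by (intro ge_one_powr_ge_zero) auto
  ultimately have "\<bar>a\<bar> * 1 \<le> \<bar>a\<bar> * (real L ^ k * real L powr (- real k * (2 - \<beta>)))"
    by (intro mult_left_mono) auto
  then show ?thesis by (simp add: coup_def abs_mult mult.left_commute)
qed

private lemma coup_tendsto_0: "coup \<longlonglongrightarrow> 0"
proof -
  have b: "1 < real L powr (2 - \<beta>)" using L \<beta> by (intro gr_one_powr) auto
  have "real L powr (- real N * (2 - \<beta>)) = inverse (real L powr (2 - \<beta>)) ^ N" for N
    using L by (subst powr_realpow[symmetric]) (simp_all add: powr_powr algebra_simps flip: powr_minus)
  then have "coup = (\<lambda>N. - a * inverse (real L powr (2 - \<beta>)) ^ N)"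
    unfolding coup_def[abs_def] by presburger
  moreover have "(\<lambda>N. inverse (real L powr (2 - \<beta>)) ^ N) \<longlonglongrightarrow> 0"
    using b by (intro LIMSEQ_power_zero) (simp add: inverse_less_1_iff)
  then have "(\<lambda>N. - a * inverse (real L powr (2 - \<beta>)) ^ N) \<longlonglongrightarrow> 0"
    by (rule tendsto_mult_right_zero)
  ultimately show ?thesis by (simp only:)
qed

private definition "gap = (1 - q\<^sup>2)\<^sup>2 / 8"

private lemma gap_pos: "0 < gap"
proof -
  have "q\<^sup>2 < 1" using q_less_1 by (simp add: power_less_one_iff)
  then show ?thesis by (simp add: gap_def)
qed

text \<open>\<open>k0\<close> is independent of the cutoff \<open>N\<close>, because after
  \<open>N - k\<close> steps the coupling is \<open>coup k\<close> and tends to 0 in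
  \<open>k\<close> alone.\<close>

private lemma rg_tilt:
  obtains k0 where "\<And>k N \<tau> \<phi>. k0 \<le> k \<Longrightarrow> k \<le> N \<Longrightarrow> \<bar>\<tau>\<bar> \<le> 1/2 \<Longrightarrow> \<tau> * coup k = - (\<bar>\<tau>\<bar> * \<bar>coup k\<bar>) \<Longrightarrow>
    (\<integral>z. rg sd (L\<^sup>2) (bare N) (N - k) (\<phi> + z) *
        exp (\<tau> * (cos (sqrt \<beta> * (\<phi> + z)) - q * cos (sqrt \<beta> * \<phi>))) \<partial>gauss sd)
      \<le> exp (4 * \<tau>\<^sup>2 - gap * \<bar>\<tau>\<bar> * \<bar>coup k\<bar>) * smooth sd (rg sd (L\<^sup>2) (bare N) (N - k)) \<phi>"
proof -
  define b where "b = real (L\<^sup>2) * q"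
  have b: "1 < b" unfolding b_def b_eq using L \<beta> by (intro gr_one_powr) auto
  then have b2: "0 < b\<^sup>2 - b" by (simp add: power2_eq_square)
  define C where "C = max 2 (8 * (real (L\<^sup>2))\<^sup>2 / (b\<^sup>2 - b))"
  have C: "2 \<le> C" by (simp add: C_def)
  have "8 * (real (L\<^sup>2))\<^sup>2 / (b\<^sup>2 - b) \<le> C" by (simp add: C_def)
  then have C': "8 * (real (L\<^sup>2))\<^sup>2 \<le> C * (b\<^sup>2 - b)" using b2 by (simp only: pos_divide_le_eq)
  \<comment> \<open>The bounds \<open>1 / C\<close> and \<open>1 / (4 * L\<^sup>2)\<close> are those
    of \<open>rg_flow\<close>. For \<open>cos_tilt\<close>, \<open>gap / C\<close> keeps the error
    below the gain, and \<open>1/4\<close> with \<open>1 / C\<close> keeps the total perturbation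
    below \<open>1/2\<close>.\<close>
  define d where "d = min (1/4) (min (1 / C) (min (1 / (4 * real (L\<^sup>2))) (gap / C)))"
  have "0 < d" using C L gap_pos by (simp add: d_def)
  then have "\<forall>\<^sub>F k in sequentially. \<bar>coup k\<bar> < d"
    by (rule order_tendstoD(2)[OF tendsto_rabs_zero[OF coup_tendsto_0]])
  then obtain k0 where k0: "\<And>k. k0 \<le> k \<Longrightarrow> \<bar>coup k\<bar> < d" by (auto simp: eventually_sequentially)
  show thesis
  proof (rule that)
    fix k N :: nat and \<tau> \<phi> :: real
    assume k: "k0 \<le> k" "k \<le> N" and \<tau>: "\<bar>\<tau>\<bar> \<le> 1/2" "\<tau> * coup k = - (\<bar>\<tau>\<bar> * \<bar>coup k\<bar>)"
    have "\<bar>coup k\<bar> \<le> 1/4" "\<bar>coup k\<bar> \<le> 1 / C" "\<bar>coup k\<bar> \<le> 1 / (4 * real (L\<^sup>2))" "\<bar>coup k\<bar> \<le> gap / C"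
      using k0[OF k(1)] by (simp_all add: d_def)
    then have small: "\<bar>coup k\<bar> \<le> 1/4" "C * \<bar>coup k\<bar> \<le> 1" "4 * real (L\<^sup>2) * \<bar>coup k\<bar> \<le> 1" "C * \<bar>coup k\<bar> \<le> gap"
      using C L by (simp_all add: pos_le_divide_eq mult.commute mult.left_commute)
    have scale: "b ^ (N - k) * coup N = coup k" using coup_step[of "N - k" k] k(2) by (simp add: b_def)
    have small3: "real (4 * L\<^sup>2) * \<bar>coup k\<bar> \<le> 1" using small(3) by simp
    obtain w h where w: "w > 0" "wiener (sqrt \<beta>) 1 (C * (coup k)\<^sup>2) h"
      "\<And>\<phi>. rg sd (L\<^sup>2) (bare N) (N - k) \<phi> = w * (1 + (coup k * cos (sqrt \<beta> * \<phi>) + h \<phi>))"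
      using rg_flow[OF sd q_eq b_def b C C', of "N - k" "coup N"] small(2) small3
      unfolding scale bare_def by metis
    have M: "C * (coup k)\<^sup>2 \<le> gap * \<bar>coup k\<bar>" "C * (coup k)\<^sup>2 \<le> 1 * \<bar>coup k\<bar>"
      using mult_right_mono[OF small(4), of "\<bar>coup k\<bar>"] mult_right_mono[OF small(2), of "\<bar>coup k\<bar>"]
      by (simp_all add: power2_eq_square mult.assoc)
    show "(\<integral>z. rg sd (L\<^sup>2) (bare N) (N - k) (\<phi> + z) *
          exp (\<tau> * (cos (sqrt \<beta> * (\<phi> + z)) - q * cos (sqrt \<beta> * \<phi>))) \<partial>gauss sd)
        \<le> exp (4 * \<tau>\<^sup>2 - gap * \<bar>\<tau>\<bar> * \<bar>coup k\<bar>) * smooth sd (rg sd (L\<^sup>2) (bare N) (N - k)) \<phi>"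
      unfolding gap_def
    proof (rule cos_tilt[OF sd q_eq w(3,1,2) _ _ \<tau>])
      show "8 * (C * (coup k)\<^sup>2) \<le> (1 - q\<^sup>2)\<^sup>2 * \<bar>coup k\<bar>" using M(1) by (simp add: gap_def)
      show "\<bar>coup k\<bar> + C * (coup k)\<^sup>2 \<le> 1/2" using M(2) small(1) by simp
    qed
  qed
qed

section \<open>Choice of the tilt and exponential separation\<close>

lemma is_hSG_mutually_singular:
  assumes "is_hSG L \<beta> a P"
  shows "mutually_singular P (hGFF L)"
proof -
  have P: "prob_space P" "sets P = sets (hGFF L)"
    and lim: "\<And>n (f :: (nat \<times> int \<times> int \<Rightarrow> real) \<Rightarrow> real). continuous_on UNIV f \<Longrightarrow> bounded (range f) \<Longrightarrow>
        (\<lambda>N. \<integral>\<omega>. f (restrict \<omega> (layers_upto L n)) \<partial>hSG_cutoff L \<beta> a N)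
          \<longlonglongrightarrow> (\<integral>\<omega>. f (restrict \<omega> (layers_upto L n)) \<partial>P)"
    using assms by (auto simp: is_hSG_def)
  interpret P: prob_space P by (rule P)
  obtain k0 where tilt: "\<And>k N \<tau> \<phi>. k0 \<le> k \<Longrightarrow> k \<le> N \<Longrightarrow> \<bar>\<tau>\<bar> \<le> 1/2 \<Longrightarrow> \<tau> * coup k = - (\<bar>\<tau>\<bar> * \<bar>coup k\<bar>) \<Longrightarrow>
    (\<integral>z. rg sd (L\<^sup>2) (bare N) (N - k) (\<phi> + z) *
        exp (\<tau> * (cos (sqrt \<beta> * (\<phi> + z)) - q * cos (sqrt \<beta> * \<phi>))) \<partial>gauss sd)
      \<le> exp (4 * \<tau>\<^sup>2 - gap * \<bar>\<tau>\<bar> * \<bar>coup k\<bar>) * smooth sd (rg sd (L\<^sup>2) (bare N) (N - k)) \<phi>"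
    using rg_tilt by blast
  \<comment> \<open>Small enough that the quadratic cost \<open>4 * t\<^sup>2\<close> is less than
    half of the linear gain \<open>gap * t * \<bar>a\<bar>\<close>.\<close>
  define t where "t = min (1/2) (gap * \<bar>a\<bar> / 16)"
  have t: "0 < t" "t \<le> 1/2" "t \<le> gap * \<bar>a\<bar> / 16" using gap_pos a by (auto simp: t_def)
  \<comment> \<open>The factor \<open>1 / L ^ k\<close> normalises a sum over
    \<open>L ^ (2 * k)\<close> sites. The sign is opposite to that of \<open>coup k\<close>, so the
    statistic drifts downwards under the Sine-Gordon measure.\<close>
  define \<tau> where "\<tau> = (\<lambda>k. t * sgn a / real L ^ k)"
  have abs_\<tau>: "\<bar>\<tau> k\<bar> = t / real L ^ k" for k
    using t(1) a L by (simp add: \<tau>_def abs_mult abs_sgn_eq)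
  have \<tau>_le: "\<bar>\<tau> k\<bar> \<le> 1/2" for k
  proof -
    have "t / real L ^ k \<le> t / 1" using t(1) L by (intro divide_left_mono) auto
    then show ?thesis unfolding abs_\<tau> using t(2) by linarith
  qed
  have \<tau>_coup: "\<tau> k * coup k = - (\<bar>\<tau> k\<bar> * \<bar>coup k\<bar>)" for k
  proof -
    have "\<tau> k * coup k = - (t / real L ^ k * ((a * sgn a) * real L powr (- real k * (2 - \<beta>))))"
      by (simp add: \<tau>_def coup_def)
    then show ?thesis unfolding abs_\<tau> abs_sgn[symmetric] by (simp add: coup_def abs_mult)
  qed
  define T where "T n = tilt_stat L (sqrt \<beta>) q \<tau> k0 n" for n
  \<comment> \<open>Cost of a whole layer: its \<open>L ^ (2 * k)\<close> sites turn the quadratic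
    term into \<open>4 * t\<^sup>2\<close> and the gain into at least
    \<open>g * t * \<bar>a\<bar>\<close>. It is used with \<open>g = gap\<close> for Sine-Gordon and
    \<open>g = 0\<close> for the free field.\<close>
  have pow: "exp (4 * (\<tau> k)\<^sup>2 - g * \<bar>\<tau> k\<bar> * \<bar>coup k\<bar>) ^ L ^ (2 * k) \<le> exp (4 * t\<^sup>2 - g * t * \<bar>a\<bar>)"
    if "0 \<le> g" for k g
  proof -
    define y where "y = real L ^ k"
    have y: "0 < y" using L by (simp add: y_def)
    have \<tau>y: "\<bar>\<tau> k\<bar> = t / y" "(\<tau> k)\<^sup>2 = t\<^sup>2 / y\<^sup>2"
      using abs_\<tau>[of k] unfolding y_def by (metis, metis power2_abs power_divide)
    have "real (L ^ (2 * k)) = y\<^sup>2" by (simp add: y_def power_mult[symmetric] mult.commute)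
    then have "real (L ^ (2 * k)) * (4 * (\<tau> k)\<^sup>2 - g * \<bar>\<tau> k\<bar> * \<bar>coup k\<bar>) =
        4 * t\<^sup>2 - g * t * (real L ^ k * \<bar>coup k\<bar>)"
      using y unfolding \<tau>y y_def[symmetric] by (simp add: field_simps power2_eq_square)
    also have "\<dots> \<le> 4 * t\<^sup>2 - g * t * \<bar>a\<bar>"
      using mult_left_mono[OF coup_scaling[of k], of "g * t"] that t(1) by simp
    finally show ?thesis unfolding exp_of_nat_mult[symmetric] by simp
  qed
  define \<rho> where "\<rho> = exp (4 * t\<^sup>2 - gap * t * \<bar>a\<bar>)"
  have cutoff: "(\<integral>\<omega>. exp (T n (restrict \<omega> (layers_upto L n))) \<partial>hSG_cutoff L \<beta> a N) \<le> \<rho> ^ (n - k0)"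
    if "k0 \<le> n" "n \<le> N" for n N
  proof -
    obtain B where B: "\<And>\<omega>. \<bar>T n \<omega>\<bar> \<le> B" using tilt_stat_abs_le unfolding T_def by metis
    show ?thesis
    proof (rule cutoff_integral_le[where B = "exp B" and k = k0])
      show "(\<lambda>\<omega>. exp (T n \<omega>)) \<in> borel_measurable (PiM (layers_upto L n) (\<lambda>_. gauss sd))"
        unfolding T_def by (rule measurable_compose[OF measurable_tilt_stat[OF L0 sd order_refl]]) simp
      show "exp (T n \<omega>) \<le> exp B" for \<omega> using B[of \<omega>] by simp
      show "(\<integral>\<^sup>+\<omega>. ennreal (exp (T n \<omega>)) * (\<Prod>x\<in>Lam L n. ennreal (rg sd (L\<^sup>2) (bare N) (N - n) (int_field L n \<omega> x)))
          \<partial>PiM (layers_upto L n) (\<lambda>_. gauss sd)) \<le>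
        ennreal (\<rho> ^ (n - k0)) * (\<integral>\<^sup>+\<omega>. (\<Prod>x\<in>Lam L k0. ennreal (rg sd (L\<^sup>2) (bare N) (N - k0) (int_field L k0 \<omega> x)))
          \<partial>PiM (layers_upto L k0) (\<lambda>_. gauss sd))"
        unfolding T_def
      proof (rule nn_integral_exp_tilt_stat[OF L0 sd that(1), where W = "\<lambda>k. rg sd (L\<^sup>2) (bare N) (N - k)"
              and c = "\<lambda>k. exp (4 * (\<tau> k)\<^sup>2 - gap * \<bar>\<tau> k\<bar> * \<bar>coup k\<bar>)"])
        fix k assume k: "k0 \<le> k" "k < n"
        show "bounded_weight (rg sd (L\<^sup>2) (bare N) (N - Suc k))"
          by (rule bounded_weight_rg[OF L0 sd bounded_bare])
        have "N - k = Suc (N - Suc k)" using k that by simp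
        then show "rg sd (L\<^sup>2) (bare N) (N - k) = (\<lambda>\<phi>. smooth sd (rg sd (L\<^sup>2) (bare N) (N - Suc k)) \<phi> ^ L\<^sup>2)"
          by simp
        show "exp (4 * (\<tau> (Suc k))\<^sup>2 - gap * \<bar>\<tau> (Suc k)\<bar> * \<bar>coup (Suc k)\<bar>) ^ L ^ (2 * Suc k) \<le> \<rho>"
          unfolding \<rho>_def using gap_pos by (intro pow) simp
        show "(\<integral>z. rg sd (L\<^sup>2) (bare N) (N - Suc k) (\<phi> + z) *
            exp (\<tau> (Suc k) * (cos (sqrt \<beta> * (\<phi> + z)) - q * cos (sqrt \<beta> * \<phi>))) \<partial>gauss sd)
          \<le> exp (4 * (\<tau> (Suc k))\<^sup>2 - gap * \<bar>\<tau> (Suc k)\<bar> * \<bar>coup (Suc k)\<bar>) *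
            smooth sd (rg sd (L\<^sup>2) (bare N) (N - Suc k)) \<phi>" for \<phi>
          using k that by (intro tilt \<tau>_le \<tau>_coup) auto
      qed (simp_all add: \<rho>_def)
    qed (use that in \<open>simp_all add: \<rho>_def\<close>)
  qed
  have cont: "continuous_on UNIV (\<lambda>\<omega>. exp (T n \<omega>))" for n
    unfolding T_def by (rule continuous_on_exp[OF continuous_tilt_stat])
  have bdd: "\<exists>B. \<forall>\<omega>. \<bar>exp (T n \<omega>)\<bar> \<le> B" for n
  proof -
    obtain B where "\<And>\<omega>. \<bar>T n \<omega>\<bar> \<le> B" using tilt_stat_abs_le unfolding T_def by metis
    then show ?thesis by (intro exI[of _ "exp B"]) (simp add: abs_le_iff)
  qed
  have T_restrict: "T n (restrict \<omega> (layers_upto L n)) = T n \<omega>" for n \<omega>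
    unfolding T_def by (rule tilt_stat_restrict[OF L0 sd order_refl])
  have T_meas: "T n \<in> borel_measurable (hGFF L)" for n
    unfolding T_def hGFF_eq by (rule measurable_tilt_stat[OF L0 sd layers_upto_subset])
  have T_meas_P: "T n \<in> borel_measurable P" for n
    unfolding measurable_cong_sets[OF P(2) refl] by (rule T_meas)
  have SG: "(\<integral>\<^sup>+\<omega>. exp (T n \<omega>) \<partial>P) \<le> ennreal (\<rho> ^ (n - k0))" if "k0 \<le> n" for n
  proof -
    obtain B where B: "\<And>\<omega>. \<bar>exp (T n \<omega>)\<bar> \<le> B" using bdd by blast
    have "bounded (range (\<lambda>\<omega>. exp (T n \<omega>)))" using B by (auto simp: bounded_iff)
    \<comment> \<open>The cutoff bound is uniform in \<open>N \<ge> n\<close>, so it survives the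
      weak limit.\<close>
    from lim[OF cont this, of n]
    have "(\<integral>\<omega>. exp (T n (restrict \<omega> (layers_upto L n))) \<partial>P) \<le> \<rho> ^ (n - k0)"
      by (rule LIMSEQ_le_const2) (use cutoff[OF that] in blast)
    moreover have "integrable P (\<lambda>\<omega>. exp (T n \<omega>))"
      using B T_meas_P by (intro P.integrable_const_bound[of _ B]) auto
    ultimately show ?thesis by (simp add: nn_integral_eq_integral T_restrict ennreal_leI)
  qed
  have GFF: "(\<integral>\<^sup>+\<omega>. exp (- T n \<omega>) \<partial>hGFF L) \<le> ennreal (exp (4 * t\<^sup>2) ^ (n - k0))" if "k0 \<le> n" for n
  proof -
    let ?Pi = "\<lambda>n. PiM (layers_upto L n) (\<lambda>_. gauss sd)"
    have "(\<integral>\<^sup>+\<omega>. exp (- T n \<omega>) \<partial>hGFF L) = (\<integral>\<^sup>+\<omega>. exp (- T n (restrict \<omega> (layers_upto L n))) \<partial>hGFF L)"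
      by (simp only: T_restrict)
    also have "\<dots> = (\<integral>\<^sup>+\<omega>. exp (- T n \<omega>) \<partial>?Pi n)"
      unfolding sd_def
    proof (rule nn_integral_hGFF[OF L])
      have "T n \<in> borel_measurable (?Pi n)" unfolding T_def by (rule measurable_tilt_stat[OF L0 sd order_refl])
      then show "(\<lambda>\<omega>. ennreal (exp (- T n \<omega>))) \<in> borel_measurable (PiM (layers_upto L n) (\<lambda>_. gauss (sqrt (2 * ln (real L)))))"
        unfolding sd_def by measurable
    qed
    \<comment> \<open>The free field is the case of the constant weight 1, a fixed point of the
      flow, with reversed tilt and no coupling; only the quadratic cost is left.\<close>
    also have "\<dots> = (\<integral>\<^sup>+\<omega>. ennreal (exp (tilt_stat L (sqrt \<beta>) q (\<lambda>k. - \<tau> k) k0 n \<omega>)) *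
        (\<Prod>x\<in>Lam L n. ennreal ((\<lambda>_ _. 1) n (int_field L n \<omega> x))) \<partial>?Pi n)"
      by (simp add: tilt_stat_uminus T_def)
    also have "\<dots> \<le> ennreal (exp (4 * t\<^sup>2) ^ (n - k0)) *
        (\<integral>\<^sup>+\<omega>. (\<Prod>x\<in>Lam L k0. ennreal ((\<lambda>_ _. 1) k0 (int_field L k0 \<omega> x))) \<partial>?Pi k0)"
    proof (rule nn_integral_exp_tilt_stat[OF L0 sd that, where c = "\<lambda>k. exp (4 * (\<tau> k)\<^sup>2)"])
      fix k :: nat
      show "exp (4 * (\<tau> (Suc k))\<^sup>2) ^ L ^ (2 * Suc k) \<le> exp (4 * t\<^sup>2)" using pow[of 0 "Suc k"] by simp
      fix \<phi> :: real
      show "(\<integral>z. 1 * exp (- \<tau> (Suc k) * (cos (sqrt \<beta> * (\<phi> + z)) - q * cos (sqrt \<beta> * \<phi>))) \<partial>gauss sd)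
          \<le> exp (4 * (\<tau> (Suc k))\<^sup>2) * smooth sd (\<lambda>_. 1) \<phi>"
        using cos_tilt[OF sd q_eq _ zero_less_one wiener_zero, where W = "\<lambda>_. 1" and \<alpha> = 0 and \<tau> = "- \<tau> (Suc k)"] \<tau>_le[of "Suc k"]
        by simp
    qed (auto simp: smooth_const[OF sd] intro!: bounded_weightI[where B = 1])
    also have "\<dots> = ennreal (exp (4 * t\<^sup>2) ^ (n - k0))"
    proof -
      interpret prob_space "?Pi k0" using sd by (intro prob_space_PiM prob_space_normal_density)
      show ?thesis by (simp add: emeasure_space_1)
    qed
    finally show ?thesis .
  qed
  \<comment> \<open>Half of the gain per layer. Since
    \<open>\<rho> = exp (4 * t\<^sup>2 - 2 * s)\<close>, the shift by \<open>s\<close> gives both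
    measures the same rate \<open>r\<close>: the Sine-Gordon bound gives up half of its gain and the
    free field receives it.\<close>
  define s where "s = gap * t * \<bar>a\<bar> / 2"
  define f where "f m \<omega> = exp (T (k0 + m) \<omega> + real m * s)" for m \<omega>
  define r where "r = exp (4 * t\<^sup>2 - s)"
  \<comment> \<open>By the choice of \<open>t\<close>, the quadratic cost is at most half of
    \<open>s\<close>, so \<open>r < 1\<close>.\<close>
  have "4 * t * t \<le> gap * \<bar>a\<bar> / 4 * t" using t by (intro mult_right_mono) auto
  also have "\<dots> < s" using t(1) gap_pos a by (simp add: s_def mult_ac)
  finally have r: "0 \<le> r" "r < 1" by (simp_all add: r_def power2_eq_square)
  show ?thesis
  proof (rule mutually_singularI_nn_integral[OF P(2) _ _ r])
    fix m
    show "f m \<in> borel_measurable (hGFF L)" unfolding f_def using T_meas[of "k0 + m"] by measurable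
    have "(\<integral>\<^sup>+\<omega>. f m \<omega> \<partial>P) = (\<integral>\<^sup>+\<omega>. ennreal (exp (real m * s)) * ennreal (exp (T (k0 + m) \<omega>)) \<partial>P)"
      by (simp add: f_def exp_add mult.commute flip: ennreal_mult)
    also have "\<dots> = ennreal (exp (real m * s)) * (\<integral>\<^sup>+\<omega>. exp (T (k0 + m) \<omega>) \<partial>P)"
      using T_meas_P[of "k0 + m"] by (intro nn_integral_cmult) measurable
    also have "\<dots> \<le> ennreal (exp (real m * s)) * ennreal (\<rho> ^ m)"
      using SG[of "k0 + m"] by (intro mult_left_mono) auto
    also have "\<dots> = ennreal (r ^ m)"
      by (simp add: \<rho>_def r_def s_def algebra_simps flip: ennreal_mult exp_of_nat_mult exp_add)
    finally show "(\<integral>\<^sup>+\<omega>. f m \<omega> \<partial>P) \<le> ennreal (r ^ m)" .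
    have "(\<integral>\<^sup>+\<omega>. 1 / f m \<omega> \<partial>hGFF L) =
        (\<integral>\<^sup>+\<omega>. ennreal (exp (- (real m * s))) * ennreal (exp (- T (k0 + m) \<omega>)) \<partial>hGFF L)"
      by (simp add: f_def divide_inverse algebra_simps flip: ennreal_mult exp_add exp_minus)
    also have "\<dots> = ennreal (exp (- (real m * s))) * (\<integral>\<^sup>+\<omega>. exp (- T (k0 + m) \<omega>) \<partial>hGFF L)"
      using T_meas[of "k0 + m"] by (intro nn_integral_cmult) measurable
    also have "\<dots> \<le> ennreal (exp (- (real m * s))) * ennreal (exp (4 * t\<^sup>2) ^ m)"
      using GFF[of "k0 + m"] by (intro mult_left_mono) auto
    also have "\<dots> = ennreal (r ^ m)"
      by (simp add: r_def algebra_simps flip: ennreal_mult exp_of_nat_mult exp_add)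
    finally show "(\<integral>\<^sup>+\<omega>. 1 / f m \<omega> \<partial>hGFF L) \<le> ennreal (r ^ m)" .
  qed (simp add: f_def)
qed

end

theorem theorem4p5:
  fixes L :: nat and \<beta> a :: real
    and P :: "(nat \<times> int \<times> int \<Rightarrow> real) measure"
  assumes "2 \<le> L" and "1 \<le> \<beta>" and "\<beta> < 2" and "a \<noteq> 0"
    and "is_hSG L \<beta> a P"
  shows "mutually_singular P (hGFF L)"
  using assms by (rule is_hSG_mutually_singular)

end
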